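(* Let $B\ge 2$ be an integer and let $(s_N)_{N\ge 0}$ be a complex sequence. Put $s_{-1}=0$ and $u_n=s_n-s_{n-1}$ for $n\ge 0$. Assume that $(u_n)$ has a linear representation $(L,(A_b)_{0\le b<B},C)$ of some dimension $d$ which is insensitive to the leftmost zeroes, i.e. $LA_0=L$. Let $Q=A_0+\dots+A_{B-1}$ and let $\rho_*$ be the joint spectral radius of $\{A_0,\dots,A_{B-1}\}$. Then there is a finite family of terms of the form $$N^{\log_B\rho}\binom{\log_B N}{m}\, e^{i\vartheta\log_B N}\,\Phi(\log_B N),$$ indexed by eigenvalues $\rho e^{i\vartheta}$ ($\rho\ge0$, $\vartheta\in\mathbb{R}$) of $Q$ whose modulus satisfies $\rho>\rho_*$, where $m$ is a nonnegative integer and $\Phi:\mathbb{R}\to\mathbb{C}$ is a $1$-periodic function, such that for every $r>\rho_*$, $s_N$ equals the sum of these terms plus $O(N^{\log_B r})$ as $N\to+\infty$. Moreover each such $1$-periodic function $\Phi$ (attached to an eigenvalue of modulus $\rho$) is H\"older continuous with exponent $\log_B(\rho/r)$ for every $r$ with $\rho_*<r<\rho$.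
   Context: For an integer $n\ge0$, its radix-$B$ expansion is the word $n_{\ell-1}\cdots n_1n_0$ over the alphabet $\{0,\dots,B-1\}$ with $n=\sum_i n_iB^i$ and $n_{\ell-1}\neq0$ (the empty word for $n=0$). A linear representation of dimension $d$ of a sequence $(u_n)$ consists of a row vector $L\in\mathbb{C}^{1\times d}$, square matrices $A_0,\dots,A_{B-1}\in\mathbb{C}^{d\times d}$ and a column vector $C\in\mathbb{C}^{d\times1}$ such that $u_n=LA_{n_{\ell-1}}\cdots A_{n_1}A_{n_0}C$ for every $n\ge0$ with radix-$B$ expansion $n_{\ell-1}\cdots n_0$ (so $u_0=LC$). For a word $w=w_1\cdots w_T$, $A_w=A_{w_1}\cdots A_{w_T}$. The joint spectral radius is $\rho_*=\lim_{T\to+\infty}\max_{|w|=T}\|A_w\|^{1/T}$ for any subordinate matrix norm. A function $f$ is H\"older continuous with exponent $\alpha$ if $\|f(y)-f(x)\|\le c|y-x|^\alpha$ for some constant $c$. *)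

theory Defs
  imports
    "Jordan_Normal_Form.Char_Poly"
    "HOL-Library.Landau_Symbols"
    Complex_Main
begin

text \<open>
  Words are lists of digits, leftmost letter first; in a radix expansion the leftmost
  letter is the most significant digit.
\<close>

definition radix_expansion :: "nat \<Rightarrow> nat \<Rightarrow> nat list \<Rightarrow> bool" where
  "radix_expansion B n w \<longleftrightarrow>
     set w \<subseteq> {..<B} \<and> (w \<noteq> [] \<longrightarrow> hd w \<noteq> 0) \<and> n = (\<Sum>i<length w. rev w ! i * B ^ i)"

definition word_prod :: "nat \<Rightarrow> (nat \<Rightarrow> complex mat) \<Rightarrow> nat list \<Rightarrow> complex mat" where
  "word_prod d A w = foldr (\<lambda>b M. A b * M) w (1\<^sub>m d)"

text \<open>
  Only the matrices \<open>A b\<close> with \<open>b < B\<close> matter; the values of \<open>A\<close> elsewhere are arbitrary.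
\<close>

definition linear_representation ::
  "nat \<Rightarrow> nat \<Rightarrow> complex mat \<Rightarrow> (nat \<Rightarrow> complex mat) \<Rightarrow> complex mat \<Rightarrow> (nat \<Rightarrow> complex) \<Rightarrow> bool"
where
  "linear_representation B d L A C u \<longleftrightarrow>
     L \<in> carrier_mat 1 d \<and> (\<forall>b<B. A b \<in> carrier_mat d d) \<and> C \<in> carrier_mat d 1 \<and>
     (\<forall>n w. radix_expansion B n w \<longrightarrow> u n = (L * word_prod d A w * C) $$ (0, 0))"

definition sum_of_mats :: "nat \<Rightarrow> nat \<Rightarrow> (nat \<Rightarrow> complex mat) \<Rightarrow> complex mat" where
  "sum_of_mats d B A = mat d d (\<lambda>(i, j). \<Sum>b<B. A b $$ (i, j))"

definition norm_on_vec :: "nat \<Rightarrow> (complex vec \<Rightarrow> real) \<Rightarrow> bool" where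
  "norm_on_vec d \<nu> \<longleftrightarrow>
     (\<forall>x\<in>carrier_vec d. 0 \<le> \<nu> x \<and> (\<nu> x = 0 \<longleftrightarrow> x = 0\<^sub>v d)) \<and>
     (\<forall>c. \<forall>x\<in>carrier_vec d. \<nu> (c \<cdot>\<^sub>v x) = cmod c * \<nu> x) \<and>
     (\<forall>x\<in>carrier_vec d. \<forall>y\<in>carrier_vec d. \<nu> (x + y) \<le> \<nu> x + \<nu> y)"

text \<open>
  The supremum is over the unit ball rather than the unit sphere so that the set is nonempty
  (and the norm equals 0) when \<open>d = 0\<close>.
\<close>

definition subordinate_norm :: "nat \<Rightarrow> (complex vec \<Rightarrow> real) \<Rightarrow> complex mat \<Rightarrow> real" where
  "subordinate_norm d \<nu> M = (SUP x\<in>{x \<in> carrier_vec d. \<nu> x \<le> 1}. \<nu> (M *\<^sub>v x))"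

text \<open>
  The limit does not depend on the vector norm \<open>\<nu>\<close>, which is kept as a parameter.
\<close>

definition joint_spectral_radius ::
  "nat \<Rightarrow> (complex vec \<Rightarrow> real) \<Rightarrow> nat \<Rightarrow> (nat \<Rightarrow> complex mat) \<Rightarrow> real" where
  "joint_spectral_radius d \<nu> B A =
     lim (\<lambda>T. Max ((\<lambda>w. root T (subordinate_norm d \<nu> (word_prod d A w))) `
                    {w. length w = T \<and> set w \<subseteq> {..<B}}))"

definition holder_continuous :: "real \<Rightarrow> (real \<Rightarrow> complex) \<Rightarrow> bool" where
  "holder_continuous \<alpha> f \<longleftrightarrow> (\<exists>c. \<forall>x y. cmod (f y - f x) \<le> c * \<bar>y - x\<bar> powr \<alpha>)"

end

theory Submission
  imports Defs "HOL-Analysis.Elementary_Metric_Spaces"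
    "Jordan_Normal_Form.Jordan_Normal_Form_Existence"
begin

text \<open>
  Let \<open>S N\<close> be the sum of the row vectors \<open>L A\<^sub>w\<close> over the expansions \<open>w\<close> of the integers below \<open>N\<close>.
  Then \<open>s N = S (N + 1) C\<close>, \<open>S (B N) = S N Q\<close>, and consecutive values of \<open>S\<close> below \<open>B\<^sup>K\<close> differ by
  \<open>O(r\<^sup>K)\<close> for every \<open>r\<close> above the joint spectral radius. Split \<open>C\<close> into generalized eigenvectors
  \<open>v\<close> of \<open>Q\<close>. For an eigenvalue \<open>l\<close> of modulus at most the joint spectral radius, \<open>S N v\<close> is negligible.
  For a larger one, \<open>S N v\<close> extends to a function \<open>f\<close> of a real argument such that \<open>f (B x)\<close> is
  obtained from \<open>f x\<close> by applying \<open>Q\<close> to \<open>v\<close>; since \<open>Q\<close> expands by \<open>\<bar>l\<bar>\<close> while the increments of \<open>S\<close>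
  grow only by \<open>r\<close>, scaling two nearby points up to distance 1 gives the Hoelder estimate.
  With \<open>x = B\<^sup>t\<close> the dilation becomes a unit shift in \<open>t\<close>, and \<open>f\<close> is a combination of the
  \<open>l\<^sup>t (t gchoose m)\<close> with 1-periodic coefficients.
\<close>

section \<open>Sequences with slowly growing increments\<close>

text \<open>The limit defining the joint spectral radius need not be attained, so every estimate is
  made for each \<open>r > R\<close> with its own constant, while the functions themselves are
  constructed without reference to \<open>r\<close>. Treating one generalized eigenvector at a time
  replaces matrices by scalar sequences; the next member of a chain is then a known inhomogeneity,
  and instead of inverting a possibly singular \<open>Q\<close> one divides by a nonzero
  \<open>l\<close>. Two obstacles shape the estimates. A Jordan block of size above 1 would bring in
  a power of the number of dilations. And non-constant smooth factors such as
  \<open>t gchoose m\<close> are Hoelder only for exponents at most 1, whereas the exponent wanted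
  exceeds 1 if the modulus of \<open>l\<close> exceeds \<open>B * r\<close>.\<close>

definition slow :: "nat \<Rightarrow> real \<Rightarrow> (nat \<Rightarrow> complex) \<Rightarrow> bool" where
  "slow B R a \<longleftrightarrow>
     (\<forall>r>R. \<exists>c\<ge>0. \<forall>K N. N < B ^ K \<longrightarrow> cmod (a (Suc N) - a N) \<le> c * r ^ K)"

text \<open>
  The model is \<open>a m N = S N ((Q - l)\<^sup>m v)\<close>, where \<open>S N\<close> is the row vector summing \<open>L A\<^sub>w\<close> over the
  expansions \<open>w\<close> of the integers below \<open>N\<close>, and \<open>(Q - l)\<^sup>p v = 0\<close>. Appending a digit \<open>b\<close> to \<open>w\<close>
  multiplies by \<open>A b\<close>, whence \<open>S (B N) = S N Q\<close>.
\<close>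

definition jordan_chain :: "nat \<Rightarrow> real \<Rightarrow> complex \<Rightarrow> nat \<Rightarrow> (nat \<Rightarrow> nat \<Rightarrow> complex) \<Rightarrow> bool" where
  "jordan_chain B R l p a \<longleftrightarrow>
     (\<forall>m N. a m (B * N) = l * a m N + a (Suc m) N) \<and> (\<forall>m. a m 0 = 0) \<and>
     (\<forall>m\<ge>p. \<forall>N. a m N = 0) \<and> (\<forall>m. slow B R (a m))"

text \<open>The induction step for arguments on the height: the first member of the shifted chain is
  the inhomogeneity in the dilation equation for \<open>a 0\<close>.\<close>

lemma jordan_chain_shift:
  "jordan_chain B R l (Suc p) a \<Longrightarrow> jordan_chain B R l p (\<lambda>m. a (Suc m))"
  unfolding jordan_chain_def by auto

lemma increments_le:
  fixes a :: "nat \<Rightarrow> complex"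
  assumes "\<And>n. M \<le> n \<Longrightarrow> n < M + k \<Longrightarrow> cmod (a (Suc n) - a n) \<le> c"
  shows "cmod (a (M + k) - a M) \<le> of_nat k * c"
  using assms
proof (induction k)
  case 0
  then show ?case by simp
next
  case (Suc k)
  have "cmod (a (M + Suc k) - a M) \<le> cmod (a (Suc (M + k)) - a (M + k)) + cmod (a (M + k) - a M)"
    using norm_triangle_ineq[of "a (Suc (M + k)) - a (M + k)" "a (M + k) - a M"] by simp
  also have "\<dots> \<le> c + of_nat k * c"
    by (intro add_mono Suc.IH) (use Suc.prems in auto)
  finally show ?case by (simp add: algebra_simps)
qed

text \<open>Passing from \<open>B * N\<close> to \<open>B * N + b\<close> crosses
  \<open>b < B\<close> unit increments, all at arguments below \<open>B ^ Suc K\<close>; the extra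
  factor \<open>r\<close> goes into the constant.\<close>

lemma slow_block:
  assumes "slow B R a" "R < r" "0 \<le> R"
  shows "\<exists>c\<ge>0. \<forall>K N b. N < B ^ K \<longrightarrow> b < B \<longrightarrow> cmod (a (B * N + b) - a (B * N)) \<le> c * r ^ K"
proof -
  obtain c where c: "c \<ge> 0" "\<And>K N. N < B ^ K \<Longrightarrow> cmod (a (Suc N) - a N) \<le> c * r ^ K"
    using assms unfolding slow_def by blast
  have "cmod (a (B * N + b) - a (B * N)) \<le> (real B * c * r) * r ^ K" if "N < B ^ K" "b < B" for K N b
  proof -
    have "cmod (a (B * N + b) - a (B * N)) \<le> real b * (c * r ^ Suc K)"
    proof (rule increments_le)
      fix n assume n: "n < B * N + b"
      have "B * N + b < B * Suc N" using that by simp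
      also have "\<dots> \<le> B * B ^ K" using that by (intro mult_left_mono) auto
      finally have "n < B ^ Suc K" using n by simp
      then show "cmod (a (Suc n) - a n) \<le> c * r ^ Suc K" by (rule c)
    qed
    also have "\<dots> \<le> real B * (c * r ^ Suc K)"
      using that c(1) assms by (intro mult_right_mono) auto
    finally show ?thesis by (simp add: mult_ac)
  qed
  moreover have "real B * c * r \<ge> 0" using c(1) assms by simp
  ultimately show ?thesis by blast
qed

text \<open>Appending a digit multiplies by \<open>l\<close> and adds an error of order
  \<open>r ^ K\<close>; as \<open>cmod l < r\<close>, this recursion cannot outgrow
  \<open>r ^ K\<close>. Applied with every \<open>r > R\<close>, it makes eigenvalues of modulus at
  most \<open>R\<close> negligible.\<close>

lemma jordan_chain_small:
  assumes "B \<ge> 2" "0 \<le> R" "R < r" "cmod l < r" "jordan_chain B R l p a"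
  shows "\<exists>c\<ge>0. \<forall>K N. N < B ^ K \<longrightarrow> cmod (a 0 N) \<le> c * r ^ K"
  using assms(5)
proof (induction p arbitrary: a)
  case 0
  then show ?case unfolding jordan_chain_def by (intro exI[of _ 0]) simp
next
  case (Suc p)
  obtain c1 where c1: "c1 \<ge> 0" "\<And>K N. N < B ^ K \<Longrightarrow> cmod (a 1 N) \<le> c1 * r ^ K"
    using Suc.IH[OF jordan_chain_shift[OF Suc.prems]] by auto
  obtain c2 where c2: "c2 \<ge> 0"
    "\<And>K N b. N < B ^ K \<Longrightarrow> b < B \<Longrightarrow> cmod (a 0 (B * N + b) - a 0 (B * N)) \<le> c2 * r ^ K"
    using slow_block[of B R "a 0" r] Suc.prems assms unfolding jordan_chain_def by blast
  \<comment> \<open>\<open>D\<close> is the fixed point of the recursion for the constant, so the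
    bound reproduces itself from \<open>K\<close> to \<open>Suc K\<close>.\<close>
  define D where "D = (c1 + c2) / (r - cmod l)"
  have D0: "D \<ge> 0" using c1 c2 assms unfolding D_def by simp
  have D: "cmod l * D + c1 + c2 = r * D" using assms unfolding D_def by (simp add: field_simps)
  have "cmod (a 0 N) \<le> D * r ^ K" if "N < B ^ K" for K N
    using that
  proof (induction K arbitrary: N)
    case 0
    then show ?case using Suc.prems D0 unfolding jordan_chain_def by simp
  next
    case (Suc K)
    define M b where "M = N div B" and "b = N mod B"
    have N: "N = B * M + b" and b: "b < B" using assms(1) unfolding M_def b_def by simp_all
    have M: "M < B ^ K" using Suc.prems unfolding M_def
      by (metis assms(1) less_mult_imp_div_less mult.commute power_Suc)
    have "a 0 N = (a 0 (B * M + b) - a 0 (B * M)) + (l * a 0 M + a 1 M)"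
      using \<open>jordan_chain B R l (Suc p) a\<close> N unfolding jordan_chain_def by simp
    also have "cmod \<dots> \<le> cmod (a 0 (B * M + b) - a 0 (B * M)) + (cmod l * cmod (a 0 M) + cmod (a 1 M))"
      using norm_triangle_ineq[of "l * a 0 M" "a 1 M"] 
      by (intro norm_triangle_mono) (auto simp: norm_mult)
    also have "\<dots> \<le> c2 * r ^ K + (cmod l * (D * r ^ K) + c1 * r ^ K)"
      by (intro add_mono mult_left_mono c2 c1 M b Suc.IH) auto
    also have "\<dots> = (cmod l * D + c1 + c2) * r ^ K" by (simp add: algebra_simps)
    also have "\<dots> = D * r ^ Suc K" unfolding D by simp
    finally show ?case .
  qed
  then show ?case using D0 by blast
qed

text \<open>Two growth rates collide: adding up fewer than \<open>B ^ K\<close> increments bounds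
  the sequence by a multiple of \<open>(B * r) ^ K\<close>, while a nonzero value would be
  multiplied by \<open>l ^ j\<close> along \<open>B ^ j * N\<close>.\<close>

lemma jordan_chain_large_eq_0:
  assumes "B \<ge> 2" "0 \<le> R" "R < r" "real B * r < cmod l" "jordan_chain B R l p a"
  shows "a 0 N = 0"
  using assms(5)
proof (induction p arbitrary: a N)
  case 0
  then show ?case unfolding jordan_chain_def by simp
next
  case (Suc p)
  \<comment> \<open>The rest of the chain vanishes by induction, so dilation by \<open>B\<close>
    multiplies \<open>a 0\<close> by exactly \<open>l\<close>.\<close>
  have 1: "a 1 M = 0" for M
    using Suc.IH[OF jordan_chain_shift[OF Suc.prems]] by simp
  have rec: "a 0 (B ^ j * N) = l ^ j * a 0 N" for j
  proof (induction j)
    case (Suc j)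
    have "a 0 (B * (B ^ j * N)) = l * a 0 (B ^ j * N)"
      using \<open>jordan_chain B R l (Suc p) a\<close> 1 unfolding jordan_chain_def by simp
    then show ?case using Suc by (simp add: mult_ac)
  qed simp
  obtain c where c: "c \<ge> 0" "\<And>K N. N < B ^ K \<Longrightarrow> cmod (a 0 (Suc N) - a 0 N) \<le> c * r ^ K"
    using Suc.prems assms unfolding jordan_chain_def slow_def by blast
  have grow: "cmod (a 0 M) \<le> c * (real B * r) ^ K" if "M < B ^ K" for M K
  proof -
    have "cmod (a 0 (0 + M) - a 0 0) \<le> real M * (c * r ^ K)"
      by (rule increments_le, rule c) (use that in simp)
    also have "\<dots> \<le> real (B ^ K) * (c * r ^ K)"
      using that c(1) assms by (intro mult_right_mono) (auto simp del: of_nat_power)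
    finally show ?thesis
      using Suc.prems unfolding jordan_chain_def by (simp add: power_mult_distrib mult_ac)
  qed
  show ?case
  proof (rule ccontr)
    assume nz: "a 0 N \<noteq> 0"
    obtain i where i: "N < B ^ i" using assms(1)
      by (metis less_exp order_less_le_trans power_mono zero_le_numeral)
    define q where "q = cmod l / (real B * r)"
    have Br: "0 < real B * r" using assms by auto
    have "q > 1" using assms Br unfolding q_def by simp
    then obtain j where j: "c * (real B * r) ^ i / cmod (a 0 N) < q ^ j"
      using real_arch_pow by blast
    have "B ^ j * N < B ^ (i + j)" using i assms(1) by (simp add: power_add)
    from grow[OF this] have "cmod l ^ j * cmod (a 0 N) \<le> c * (real B * r) ^ i * (real B * r) ^ j"
      unfolding rec by (simp add: norm_mult norm_power power_add)
    then have "q ^ j * cmod (a 0 N) \<le> c * (real B * r) ^ i"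
      using zero_less_power[OF Br, of j]
      unfolding q_def power_divide times_divide_eq_left by (simp only: pos_divide_le_eq)
    then show False using j nz by (simp add: divide_simps)
  qed
qed

section \<open>Extension to a real argument\<close>

text \<open>
  \<open>f m x\<close> plays the role of the limit of \<open>S (\<lfloor>B\<^sup>k x\<rfloor>) Q\<^sup>-\<^sup>k (Q - l)\<^sup>m v\<close>: its components solve the dilation
  equation on the whole half-line, and at integers it gives back the sequences themselves.
\<close>

definition chain_extension ::
  "nat \<Rightarrow> real \<Rightarrow> complex \<Rightarrow> nat \<Rightarrow> (nat \<Rightarrow> nat \<Rightarrow> complex) \<Rightarrow> (nat \<Rightarrow> real \<Rightarrow> complex) \<Rightarrow> bool" where
  "chain_extension B R l p a f \<longleftrightarrow>
     (\<forall>m. \<forall>x\<ge>0. f m (real B * x) = l * f m x + f (Suc m) x) \<and>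
     (\<forall>m N. f m (real N) = a m N) \<and>
     (\<forall>m r. R < r \<longrightarrow> r < cmod l \<longrightarrow>
       (\<exists>c\<ge>0. \<forall>K x. 0 \<le> x \<longrightarrow> x < real B ^ K \<longrightarrow> cmod (f m x - a m (nat \<lfloor>x\<rfloor>)) \<le> c * r ^ K)) \<and>
     (\<forall>m\<ge>p. \<forall>x\<ge>0. f m x = 0)"

lemma nat_floor_less_power:
  assumes "0 \<le> x" "x < real B ^ K"
  shows "nat \<lfloor>x\<rfloor> < B ^ K"
  using assms by (metis floor_less_iff nat_less_iff of_int_of_nat_eq of_nat_power zero_le_floor)

text \<open>Multiplying a real number by \<open>B\<close> appends one digit to its integer part,
  which reduces real dilations to \<open>slow_block\<close>.\<close>

lemma nat_floor_mult:
  assumes "B > 0" "0 \<le> x"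
  obtains b where "b < B" "nat \<lfloor>real B * x\<rfloor> = B * nat \<lfloor>x\<rfloor> + b"
proof -
  define M where "M = nat \<lfloor>x\<rfloor>"
  define Y where "Y = nat \<lfloor>real B * x\<rfloor>"
  have M: "real M \<le> x" "x < real M + 1" using assms unfolding M_def by linarith+
  have Y: "real Y \<le> real B * x" "real B * x < real Y + 1"
  proof -
    have "0 \<le> real B * x" using assms by simp
    then show "real Y \<le> real B * x" "real B * x < real Y + 1" unfolding Y_def by linarith+
  qed
  have "real B * real M \<le> real B * x" "real B * x < real B * (real M + 1)"
    using M assms by auto
  then have "real (B * M) < real (Y + 1)" "real Y < real (B * (M + 1))" using Y by (auto simp: algebra_simps)
  then have "B * M < Y + 1" "Y < B * (M + 1)" using of_nat_less_iff by blast+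
  then have "Y - B * M < B" "Y = B * M + (Y - B * M)" by auto
  then show ?thesis using that unfolding M_def Y_def by blast
qed

text \<open>One inhomogeneous dilation equation, \<open>f'\<close> being the extension already found
  for the next member. Dividing by \<open>l\<close> at each step against growth at a rate
  \<open>r < cmod l\<close> makes the solution a convergent series.\<close>

lemma chain_extension_step:
  fixes a a' :: "nat \<Rightarrow> complex" and f' :: "real \<Rightarrow> complex"
  assumes B: "B \<ge> 2" and R: "0 \<le> R" "R < cmod l"
    and rec: "\<And>N. a (B * N) = l * a N + a' N"
    and slow: "slow B R a"
    and f'N: "\<And>N. f' (real N) = a' N"
    and f': "\<And>r. R < r \<Longrightarrow> r < cmod l \<Longrightarrow>
      \<exists>c\<ge>0. \<forall>K x. 0 \<le> x \<longrightarrow> x < real B ^ K \<longrightarrow> cmod (f' x - a' (nat \<lfloor>x\<rfloor>)) \<le> c * r ^ K"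
  obtains f where
    "\<And>x. x \<ge> 0 \<Longrightarrow> f (real B * x) = l * f x + f' x"
    "\<And>N. f (real N) = a N"
    "\<And>r. R < r \<Longrightarrow> r < cmod l \<Longrightarrow>
      \<exists>c\<ge>0. \<forall>K x. 0 \<le> x \<longrightarrow> x < real B ^ K \<longrightarrow> cmod (f x - a (nat \<lfloor>x\<rfloor>)) \<le> c * r ^ K"
proof -
  have l0: "l \<noteq> 0" using R by auto
  \<comment> \<open>Writing \<open>f = a \<circ> floor + e\<close>, the equation for \<open>f\<close> becomes \<open>e (B x) = l e x + h x\<close>,
    which is solved by summing backwards along the orbit \<open>x, B x, B\<^sup>2 x, \<dots>\<close>.\<close>
  define h where "h x = f' x + l * a (nat \<lfloor>x\<rfloor>) - a (nat \<lfloor>real B * x\<rfloor>)" for x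
  define T where "T x k = - (h (real B ^ k * x) / l ^ Suc k)" for x k
  define f where "f x = a (nat \<lfloor>x\<rfloor>) + suminf (T x)" for x
  have h: "\<exists>c\<ge>0. \<forall>K x. 0 \<le> x \<longrightarrow> x < real B ^ K \<longrightarrow> cmod (h x) \<le> c * r ^ K"
    if r: "R < r" "r < cmod l" for r
  proof -
    obtain c1 where c1: "c1 \<ge> 0"
      "\<And>K x. 0 \<le> x \<Longrightarrow> x < real B ^ K \<Longrightarrow> cmod (f' x - a' (nat \<lfloor>x\<rfloor>)) \<le> c1 * r ^ K"
      using f'[OF r] by blast
    obtain c2 where c2: "c2 \<ge> 0"
      "\<And>K N b. N < B ^ K \<Longrightarrow> b < B \<Longrightarrow> cmod (a (B * N + b) - a (B * N)) \<le> c2 * r ^ K"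
      using slow_block[OF slow r(1) R(1)] by blast
    have "cmod (h x) \<le> (c1 + c2) * r ^ K" if x: "0 \<le> x" "x < real B ^ K" for K x
    proof -
      obtain b where b: "b < B" "nat \<lfloor>real B * x\<rfloor> = B * nat \<lfloor>x\<rfloor> + b"
        using nat_floor_mult[of B x] x B by auto
      \<comment> \<open>Two controlled deviations: that of \<open>f'\<close> from its value at the
        integer part, and that of \<open>a\<close> over one appended digit.\<close>
      have "h x = (f' x - a' (nat \<lfloor>x\<rfloor>)) - (a (B * nat \<lfloor>x\<rfloor> + b) - a (B * nat \<lfloor>x\<rfloor>))"
        unfolding h_def b(2) rec by simp
      also have "cmod \<dots> \<le> c1 * r ^ K + c2 * r ^ K"
        using c1(2)[OF x] c2(2)[OF nat_floor_less_power[OF x] b(1)]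
        by (rule norm_triangle_le_diff[OF add_mono])
      finally show ?thesis by (simp add: algebra_simps)
    qed
    then show ?thesis using c1 c2 by (intro exI[of _ "c1 + c2"]) auto
  qed
  have T: "\<exists>c\<ge>0. \<forall>K x. 0 \<le> x \<longrightarrow> x < real B ^ K \<longrightarrow> summable (T x) \<and> cmod (suminf (T x)) \<le> c * r ^ K"
    if r: "R < r" "r < cmod l" for r
  proof -
    obtain c where c: "c \<ge> 0" "\<And>K x. 0 \<le> x \<Longrightarrow> x < real B ^ K \<Longrightarrow> cmod (h x) \<le> c * r ^ K"
      using h[OF r] by blast
    define q where "q = r / cmod l"
    have q: "0 \<le> q" "q < 1" using r R l0 unfolding q_def by (auto simp: divide_less_eq)
    have "summable (T x) \<and> cmod (suminf (T x)) \<le> (c / cmod l / (1 - q)) * r ^ K"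
      if x: "0 \<le> x" "x < real B ^ K" for K x
    proof -
      have bd: "norm (T x k) \<le> (c / cmod l * r ^ K) * q ^ k" for k
      proof -
        \<comment> \<open>Dilation by \<open>B ^ k\<close> raises the bound on \<open>h\<close> by
          \<open>r ^ k\<close> only, against \<open>cmod l ^ k\<close> in the denominator: the ratio
          is \<open>q\<close>.\<close>
        have "real B ^ k * x < real B ^ (K + k)" using x B by (simp add: power_add)
        then have "cmod (h (real B ^ k * x)) \<le> c * r ^ (K + k)" using x by (intro c) auto
        then have "norm (T x k) \<le> c * r ^ (K + k) / cmod l ^ Suc k"
          unfolding T_def by (simp add: norm_divide norm_mult norm_power divide_right_mono)
        also have "\<dots> = (c / cmod l * r ^ K) * q ^ k"
          unfolding q_def by (simp add: power_add power_divide)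
        finally show ?thesis .
      qed
      have g: "(\<lambda>k. (c / cmod l * r ^ K) * q ^ k) sums ((c / cmod l * r ^ K) * (1 / (1 - q)))"
        by (intro sums_mult geometric_sums) (use q in auto)
      have sn: "summable (\<lambda>k. norm (T x k))"
        by (rule summable_comparison_test'[OF sums_summable[OF g], of 0]) (use bd in auto)
      have "cmod (suminf (T x)) \<le> (\<Sum>k. norm (T x k))" by (rule summable_norm[OF sn])
      also have "\<dots> \<le> (\<Sum>k. (c / cmod l * r ^ K) * q ^ k)"
        by (rule suminf_le[OF bd sn sums_summable[OF g]])
      also have "\<dots> = (c / cmod l / (1 - q)) * r ^ K" using sums_unique[OF g] by simp
      finally show ?thesis using summable_norm_cancel[OF sn] by simp
    qed
    moreover have "c / cmod l / (1 - q) \<ge> 0" using c q by simp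
    ultimately show ?thesis by blast
  qed
  have summ: "summable (T x)" if "x \<ge> 0" for x
  proof -
    obtain r where "R < r" "r < cmod l" using R dense by blast
    moreover obtain K where "x < real B ^ K" using real_arch_pow[of "real B" x] B by auto
    ultimately show ?thesis using T that by meson
  qed
  show ?thesis
  proof
    fix x :: real assume x: "x \<ge> 0"
    have "suminf (T x) = T x 0 + (\<Sum>k. T x (Suc k))"
      using suminf_split_head[OF summ[OF x]] by simp
    also have "(\<lambda>k. T x (Suc k)) = (\<lambda>k. T (real B * x) k / l)"
      unfolding T_def by (auto simp: mult_ac)
    also have "(\<Sum>k. T (real B * x) k / l) = suminf (T (real B * x)) / l"
      by (rule suminf_divide, rule summ) (use x in simp)
    finally have "suminf (T (real B * x)) = l * suminf (T x) + h x"
      using l0 unfolding T_def by (simp add: field_simps)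
    then show "f (real B * x) = l * f x + f' x"
      unfolding f_def h_def by (simp add: algebra_simps)
  next
    fix N :: nat
    \<comment> \<open>Integers are unchanged by \<open>floor\<close>, and the recursion for
      \<open>a\<close> cancels \<open>f'\<close>; the correction series is zero there, so
      \<open>f\<close> extends \<open>a\<close>.\<close>
    have "h (real M) = 0" for M
    proof -
      have "nat \<lfloor>real B * real M\<rfloor> = B * M" by (metis floor_of_nat nat_int of_nat_mult)
      then show ?thesis unfolding h_def by (simp add: f'N rec)
    qed
    from this[of "B ^ k * N" for k] have "T (real N) = (\<lambda>_. 0)" unfolding T_def by simp
    then show "f (real N) = a N" unfolding f_def by simp
  next
    fix r assume "R < r" "r < cmod l"
    from T[OF this] show
      "\<exists>c\<ge>0. \<forall>K x. 0 \<le> x \<longrightarrow> x < real B ^ K \<longrightarrow> cmod (f x - a (nat \<lfloor>x\<rfloor>)) \<le> c * r ^ K"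
      unfolding f_def by (simp, meson)
  qed
qed

text \<open>The equation for one member involves the next, so the functions are built from the
  vanishing end of the chain towards its start.\<close>

lemma chain_extension_exists:
  assumes "B \<ge> 2" "0 \<le> R" "R < cmod l" "jordan_chain B R l p a"
  shows "\<exists>f. chain_extension B R l p a f"
  using assms(4)
proof (induction p arbitrary: a)
  case 0
  then show ?case unfolding jordan_chain_def chain_extension_def
    by (intro exI[of _ "\<lambda>_ _. 0"]) auto
next
  case (Suc p)
  obtain f where f: "chain_extension B R l p (\<lambda>m. a (Suc m)) f"
    using Suc.IH[OF jordan_chain_shift[OF Suc.prems]] by blast
  obtain f0 where f0:
    "\<And>x. x \<ge> 0 \<Longrightarrow> f0 (real B * x) = l * f0 x + f 0 x"
    "\<And>N. f0 (real N) = a 0 N"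
    "\<And>r. R < r \<Longrightarrow> r < cmod l \<Longrightarrow>
      \<exists>c\<ge>0. \<forall>K x. 0 \<le> x \<longrightarrow> x < real B ^ K \<longrightarrow> cmod (f0 x - a 0 (nat \<lfloor>x\<rfloor>)) \<le> c * r ^ K"
  proof (rule chain_extension_step[OF assms(1-3), of "a 0" "a 1" "f 0"])
    show "slow B R (a 0)" "\<And>N. a 0 (B * N) = l * a 0 N + a 1 N"
      using Suc.prems unfolding jordan_chain_def by simp_all
    show "\<And>N. f 0 (real N) = a 1 N" using f unfolding chain_extension_def by simp
    show "\<exists>c\<ge>0. \<forall>K x. 0 \<le> x \<longrightarrow> x < real B ^ K \<longrightarrow> cmod (f 0 x - a 1 (nat \<lfloor>x\<rfloor>)) \<le> c * r ^ K"
      if "R < r" "r < cmod l" for r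
      using f that unfolding chain_extension_def by simp
  qed (rule that)
  have "chain_extension B R l (Suc p) a (case_nat f0 f)"
    unfolding chain_extension_def
  proof (intro conjI allI impI)
    show "case_nat f0 f m (real B * x) = l * case_nat f0 f m x + case_nat f0 f (Suc m) x"
      if "x \<ge> 0" for m x
      using f f0(1) that unfolding chain_extension_def by (cases m) auto
    show "case_nat f0 f m (real N) = a m N" for m N
      using f f0(2) unfolding chain_extension_def by (cases m) auto
    show "\<exists>c\<ge>0. \<forall>K x. 0 \<le> x \<longrightarrow> x < real B ^ K \<longrightarrow>
        cmod (case_nat f0 f m x - a m (nat \<lfloor>x\<rfloor>)) \<le> c * r ^ K" if "R < r" "r < cmod l" for m r
      using f f0(3) that unfolding chain_extension_def by (cases m) auto
    show "case_nat f0 f m x = 0" if "Suc p \<le> m" "0 \<le> x" for m x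
      using f that unfolding chain_extension_def by (cases m) auto
  qed
  then show ?case by blast
qed

text \<open>Points at distance at most \<open>1 / B ^ k\<close> come to distance at most 1 after
  \<open>k\<close> dilations. Undoing these divides by \<open>l ^ k\<close>, and the dilated points
  lie below \<open>B ^ (i + k)\<close>, where unit increments are of order
  \<open>r ^ (i + k)\<close>. The range \<open>i\<close> stays free because it grows during the
  scaling.\<close>

lemma chain_extension_dist_le:
  assumes B: "B \<ge> 2" and R: "0 \<le> R" and chain: "jordan_chain B R l p a"
    and ext: "chain_extension B R l p a f"
    and r: "R < r" "r < cmod l"
  shows "\<exists>c\<ge>0. \<forall>i k x y. 0 \<le> x \<longrightarrow> 0 \<le> y \<longrightarrow> x < real B ^ i \<longrightarrow> y < real B ^ i \<longrightarrow>
      \<bar>x - y\<bar> * real B ^ k \<le> 1 \<longrightarrow> cmod (f m x - f m y) \<le> c * r ^ (i + k) / cmod l ^ k"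
  using r
proof (induction "p - m" arbitrary: m r)
  case 0
  then show ?case using ext unfolding chain_extension_def by (intro exI[of _ 0]) auto
next
  case (Suc n)
  \<comment> \<open>The smaller rate \<open>s\<close> for the next member of the chain makes the errors picked up while
    scaling \<open>x, y\<close> by \<open>B\<^sup>k\<close> a convergent geometric series, with no polynomial factor in \<open>k\<close>.\<close>
  obtain s where s: "R < s" "s < r" using dense[OF Suc.prems(1)] by blast
  have s0: "s > 0" and r0: "r > 0" and l0: "cmod l > 0" using s R Suc.prems by auto
  obtain c' where c': "c' \<ge> 0" "\<And>i k x y. \<lbrakk>0 \<le> x; 0 \<le> y; x < real B ^ i; y < real B ^ i;
      \<bar>x - y\<bar> * real B ^ k \<le> 1\<rbrakk> \<Longrightarrow> cmod (f (Suc m) x - f (Suc m) y) \<le> c' * s ^ (i + k) / cmod l ^ k"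
  proof -
    have "n = p - Suc m" "s < cmod l" using Suc.hyps(2) s Suc.prems by auto
    from Suc.hyps(1)[OF this(1) s(1) this(2)] show ?thesis using that by blast
  qed
  obtain c1 where c1: "c1 \<ge> 0"
    "\<And>K x. 0 \<le> x \<Longrightarrow> x < real B ^ K \<Longrightarrow> cmod (f m x - a m (nat \<lfloor>x\<rfloor>)) \<le> c1 * r ^ K"
    using ext Suc.prems unfolding chain_extension_def by blast
  obtain c2 where c2: "c2 \<ge> 0" "\<And>K N. N < B ^ K \<Longrightarrow> cmod (a m (Suc N) - a m N) \<le> c2 * r ^ K"
    using chain Suc.prems unfolding jordan_chain_def slow_def by blast
  have a_le: "cmod (a m (nat \<lfloor>x\<rfloor>) - a m (nat \<lfloor>y\<rfloor>)) \<le> c2 * r ^ i"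
    if "0 \<le> x" "x \<le> y" "y < real B ^ i" "y - x \<le> 1" for x y i
  proof -
    have "nat \<lfloor>y\<rfloor> = nat \<lfloor>x\<rfloor> \<or> nat \<lfloor>y\<rfloor> = Suc (nat \<lfloor>x\<rfloor>)" using that by linarith
    moreover have "nat \<lfloor>x\<rfloor> < B ^ i" using that by (intro nat_floor_less_power) auto
    ultimately show ?thesis using c2 r0 by (auto simp: norm_minus_commute)
  qed
  \<comment> \<open>The case \<open>k = 0\<close>: the integer parts are equal or
    consecutive.\<close>
  have base: "cmod (f m x - f m y) \<le> (2 * c1 + c2) * r ^ i"
    if xy: "0 \<le> x" "0 \<le> y" "x < real B ^ i" "y < real B ^ i" "\<bar>x - y\<bar> \<le> 1" for x y i
  proof -
    have "cmod (a m (nat \<lfloor>x\<rfloor>) - a m (nat \<lfloor>y\<rfloor>)) \<le> c2 * r ^ i"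
    proof (cases "x \<le> y")
      case True
      then show ?thesis using a_le[of x y i] xy by simp
    next
      case False
      then show ?thesis using a_le[of y x i] xy by (simp add: norm_minus_commute)
    qed
    moreover have "f m x - f m y = (f m x - a m (nat \<lfloor>x\<rfloor>))
        + (a m (nat \<lfloor>x\<rfloor>) - a m (nat \<lfloor>y\<rfloor>)) - (f m y - a m (nat \<lfloor>y\<rfloor>))" by simp
    ultimately show ?thesis
      using c1(2)[of x i] c1(2)[of y i] xy
        norm_triangle_ineq4[of "(f m x - a m (nat \<lfloor>x\<rfloor>)) + (a m (nat \<lfloor>x\<rfloor>) - a m (nat \<lfloor>y\<rfloor>))" "f m y - a m (nat \<lfloor>y\<rfloor>)"]
        norm_triangle_ineq[of "f m x - a m (nat \<lfloor>x\<rfloor>)" "a m (nat \<lfloor>x\<rfloor>) - a m (nat \<lfloor>y\<rfloor>)"]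
      by (simp add: algebra_simps)
  qed
  define q where "q = s / r"
  have q: "0 \<le> q" "q < 1" using s s0 r0 unfolding q_def by auto
  \<comment> \<open>The constant after \<open>k\<close> dilations: that of the base case plus the
    errors inherited from \<open>f (Suc m)\<close>, each smaller than the one before by the factor
    \<open>q\<close>.\<close>
  define C where "C k = (2 * c1 + c2) + c' / r * (\<Sum>j<k. q ^ j)" for k
  have C0: "C k \<ge> 0" for k using c1 c2 c' q r0 unfolding C_def
    by (intro add_nonneg_nonneg mult_nonneg_nonneg sum_nonneg) auto
  have main: "cmod (f m x - f m y) \<le> C k * r ^ (i + k) / cmod l ^ k"
    if "0 \<le> x" "0 \<le> y" "x < real B ^ i" "y < real B ^ i" "\<bar>x - y\<bar> * real B ^ k \<le> 1" for i k x y
    using that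
  proof (induction k arbitrary: x y i)
    case 0
    then show ?case using base[of x y i] unfolding C_def by simp
  next
    case (Suc k)
    let ?x = "real B * x" and ?y = "real B * y"
    have "\<bar>?x - ?y\<bar> * real B ^ k \<le> 1"
    proof -
      have "\<bar>?x - ?y\<bar> = real B * \<bar>x - y\<bar>"
        by (metis abs_mult abs_of_nat right_diff_distrib)
      then show ?thesis using Suc.prems(5) by (simp add: mult_ac)
    qed
    then have 1: "cmod (f m ?x - f m ?y) \<le> C k * r ^ (Suc i + k) / cmod l ^ k"
      using Suc.prems B by (intro Suc.IH) auto
    have "\<bar>x - y\<bar> * real B ^ k \<le> \<bar>x - y\<bar> * real B ^ Suc k"
      using B by (intro mult_left_mono power_increasing) auto
    then have "cmod (f (Suc m) x - f (Suc m) y) \<le> c' * s ^ (i + k) / cmod l ^ k"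
      using Suc.prems by (intro c'(2)) auto
    also have "s ^ (i + k) \<le> r ^ (i + k) * q ^ k"
    proof -
      have "s ^ (i + k) = (r ^ (i + k) * q ^ k) * q ^ i"
        using r0 unfolding q_def by (simp add: power_divide power_add)
      then show ?thesis
        using q r0 by (auto intro!: mult_left_le power_le_one)
    qed
    also have "c' * (r ^ (i + k) * q ^ k) / cmod l ^ k
        = c' / r * q ^ k * r ^ (i + Suc k) / cmod l ^ k"
      using r0 by (simp add: mult_ac)
    finally have 2: "cmod (f (Suc m) x - f (Suc m) y) \<le> c' / r * q ^ k * r ^ (i + Suc k) / cmod l ^ k"
      using c' l0 by (simp add: divide_right_mono mult_left_mono)
    have "f m ?x - f m ?y = l * (f m x - f m y) + (f (Suc m) x - f (Suc m) y)"
      using ext Suc.prems unfolding chain_extension_def by (simp add: algebra_simps)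
    then have "cmod l * cmod (f m x - f m y) \<le>
        cmod (f m ?x - f m ?y) + cmod (f (Suc m) x - f (Suc m) y)"
      by (metis add_diff_cancel_right' norm_mult norm_triangle_ineq4)
    also have "\<dots> \<le> (C k + c' / r * q ^ k) * r ^ (i + Suc k) / cmod l ^ k"
      using 1 2 by (simp add: algebra_simps add_divide_distrib)
    also have "C k + c' / r * q ^ k = C (Suc k)" unfolding C_def by (simp add: algebra_simps)
    finally show ?case using l0 by (simp add: field_simps)
  qed
  have "C k \<le> (2 * c1 + c2) + c' / r * (1 / (1 - q))" for k
  proof -
    have "(\<Sum>j<k. q ^ j) \<le> (\<Sum>j. q ^ j)"
      using q by (intro sum_le_suminf summable_geometric) auto
    then have "(\<Sum>j<k. q ^ j) \<le> 1 / (1 - q)" using suminf_geometric[of q] q by simp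
    then show ?thesis unfolding C_def using c' r0 by (intro add_left_mono mult_left_mono) auto
  qed
  then have "C k * r ^ (i + k) / cmod l ^ k
      \<le> ((2 * c1 + c2) + c' / r * (1 / (1 - q))) * r ^ (i + k) / cmod l ^ k" for k i
    using r0 l0 by (intro divide_right_mono mult_right_mono) auto
  moreover have "(2 * c1 + c2) + c' / r * (1 / (1 - q)) \<ge> 0" using c1 c2 c' q r0 by auto
  ultimately show ?case using main by (meson order_trans)
qed

section \<open>Hoelder functions and periodic coefficients\<close>

text \<open>Restricted to a set because factors such as \<open>t gchoose m\<close> and
  \<open>b powr t\<close> are in general not Hoelder on the whole line, only on the bounded
  intervals to which periodicity reduces the claim.\<close>

definition holder_on :: "real set \<Rightarrow> real \<Rightarrow> (real \<Rightarrow> complex) \<Rightarrow> bool" where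
  "holder_on I \<alpha> f \<longleftrightarrow> (\<exists>c\<ge>0. \<forall>x\<in>I. \<forall>y\<in>I. cmod (f x - f y) \<le> c * \<bar>x - y\<bar> powr \<alpha>)"

lemma holder_on_const: "holder_on I \<alpha> (\<lambda>_. c)"
  unfolding holder_on_def by (intro exI[of _ 0]) simp

lemma holder_on_add:
  assumes "holder_on I \<alpha> f" "holder_on I \<alpha> g"
  shows "holder_on I \<alpha> (\<lambda>t. f t + g t)"
proof -
  obtain c where c: "c \<ge> 0" "\<And>x y. x \<in> I \<Longrightarrow> y \<in> I \<Longrightarrow> cmod (f x - f y) \<le> c * \<bar>x - y\<bar> powr \<alpha>"
    using assms(1) unfolding holder_on_def by blast
  obtain c' where c': "c' \<ge> 0" "\<And>x y. x \<in> I \<Longrightarrow> y \<in> I \<Longrightarrow> cmod (g x - g y) \<le> c' * \<bar>x - y\<bar> powr \<alpha>"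
    using assms(2) unfolding holder_on_def by blast
  have "cmod (f x + g x - (f y + g y)) \<le> (c + c') * \<bar>x - y\<bar> powr \<alpha>" if "x \<in> I" "y \<in> I" for x y
    using norm_triangle_mono[OF c(2)[OF that] c'(2)[OF that]] by (simp add: algebra_simps)
  then show ?thesis unfolding holder_on_def using c(1) c'(1) by (intro exI[of _ "c + c'"]) auto
qed

lemma holder_on_bounded:
  assumes "holder_on {u..v} \<alpha> f" "0 < \<alpha>"
  obtains M where "M \<ge> 0" "\<And>x. x \<in> {u..v} \<Longrightarrow> cmod (f x) \<le> M"
proof -
  obtain c where c: "c \<ge> 0"
    "\<And>x y. x \<in> {u..v} \<Longrightarrow> y \<in> {u..v} \<Longrightarrow> cmod (f x - f y) \<le> c * \<bar>x - y\<bar> powr \<alpha>"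
    using assms(1) unfolding holder_on_def by blast
  have "cmod (f x) \<le> c * (v - u) powr \<alpha> + cmod (f u)" if x: "x \<in> {u..v}" for x
  proof -
    have "cmod (f x - f u) \<le> c * \<bar>x - u\<bar> powr \<alpha>" using x by (intro c(2)) auto
    also have "\<dots> \<le> c * (v - u) powr \<alpha>"
      using x c assms by (intro mult_left_mono powr_mono2) auto
    finally show ?thesis using norm_triangle_ineq2[of "f x" "f u"] by linarith
  qed
  then show ?thesis using that[of "c * (v - u) powr \<alpha> + cmod (f u)"] c(1) by simp
qed

text \<open>The product estimate needs both factors bounded, which a bounded interval and a positive
  exponent provide.\<close>

lemma holder_on_mult:
  assumes "holder_on {u..v} \<alpha> f" "holder_on {u..v} \<alpha> g" "0 < \<alpha>"
  shows "holder_on {u..v} \<alpha> (\<lambda>t. f t * g t)"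
proof -
  let ?I = "{u..v}"
  obtain c where c: "c \<ge> 0" "\<And>x y. x \<in> ?I \<Longrightarrow> y \<in> ?I \<Longrightarrow> cmod (f x - f y) \<le> c * \<bar>x - y\<bar> powr \<alpha>"
    using assms(1) unfolding holder_on_def by blast
  obtain c' where c': "c' \<ge> 0" "\<And>x y. x \<in> ?I \<Longrightarrow> y \<in> ?I \<Longrightarrow> cmod (g x - g y) \<le> c' * \<bar>x - y\<bar> powr \<alpha>"
    using assms(2) unfolding holder_on_def by blast
  obtain M where M: "M \<ge> 0" "\<And>x. x \<in> ?I \<Longrightarrow> cmod (f x) \<le> M"
    using holder_on_bounded[OF assms(1,3)] by blast
  obtain M' where M': "M' \<ge> 0" "\<And>x. x \<in> ?I \<Longrightarrow> cmod (g x) \<le> M'"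
    using holder_on_bounded[OF assms(2,3)] by blast
  have "cmod (f x * g x - f y * g y) \<le> (M * c' + c * M') * \<bar>x - y\<bar> powr \<alpha>"
    if xy: "x \<in> ?I" "y \<in> ?I" for x y
  proof -
    have "f x * g x - f y * g y = f x * (g x - g y) + (f x - f y) * g y"
      by (simp add: algebra_simps)
    also have "cmod \<dots> \<le> cmod (f x) * cmod (g x - g y) + cmod (f x - f y) * cmod (g y)"
      by (metis norm_mult norm_triangle_ineq)
    also have "\<dots> \<le> M * (c' * \<bar>x - y\<bar> powr \<alpha>) + (c * \<bar>x - y\<bar> powr \<alpha>) * M'"
      using xy c c' M M' by (intro add_mono mult_mono) auto
    finally show ?thesis by (simp add: algebra_simps)
  qed
  then show ?thesis unfolding holder_on_def using c(1) c'(1) M(1) M'(1)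
    by (intro exI[of _ "M * c' + c * M'"]) auto
qed

lemma holder_on_diff:
  assumes "holder_on {u..v} \<alpha> f" "holder_on {u..v} \<alpha> g" "0 < \<alpha>"
  shows "holder_on {u..v} \<alpha> (\<lambda>t. f t - g t)"
  using holder_on_add[OF assms(1) holder_on_mult[OF holder_on_const[of _ _ "-1"] assms(2,3)]]
  by simp

text \<open>For \<open>\<alpha> \<le> 1\<close> the surplus
  \<open>\<bar>x - y\<bar> powr (1 - \<alpha>)\<close> is bounded by a power of the length of the
  interval. This is the origin of the restriction on exponents in the smooth factors below.\<close>

lemma holder_on_lipschitz:
  assumes "0 \<le> c" "\<alpha> \<le> 1"
    and "\<And>x y. x \<in> {u..v} \<Longrightarrow> y \<in> {u..v} \<Longrightarrow> cmod (f x - f y) \<le> c * \<bar>x - y\<bar>"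
  shows "holder_on {u..v} \<alpha> f"
proof -
  have "cmod (f x - f y) \<le> (c * (v - u) powr (1 - \<alpha>)) * \<bar>x - y\<bar> powr \<alpha>"
    if xy: "x \<in> {u..v}" "y \<in> {u..v}" for x y
  proof (cases "x = y")
    case False
    have "cmod (f x - f y) \<le> c * (\<bar>x - y\<bar> powr (1 - \<alpha>) * \<bar>x - y\<bar> powr \<alpha>)"
      using assms(3)[OF xy] False by (simp add: powr_add[symmetric])
    also have "\<dots> \<le> c * ((v - u) powr (1 - \<alpha>) * \<bar>x - y\<bar> powr \<alpha>)"
      using xy assms by (intro mult_left_mono mult_right_mono powr_mono2) auto
    finally show ?thesis by (simp add: mult_ac)
  qed simp
  then show ?thesis unfolding holder_on_def using assms(1)
    by (intro exI[of _ "c * (v - u) powr (1 - \<alpha>)"]) auto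
qed

lemma holder_on_of_real_deriv:
  fixes g :: "real \<Rightarrow> real"
  assumes "\<alpha> \<le> 1" "0 \<le> c"
    and "\<And>x. x \<in> {u..v} \<Longrightarrow> (g has_real_derivative g' x) (at x)"
    and "\<And>x. x \<in> {u..v} \<Longrightarrow> \<bar>g' x\<bar> \<le> c"
  shows "holder_on {u..v} \<alpha> (\<lambda>t. of_real (g t))"
proof (rule holder_on_lipschitz[OF assms(2,1)])
  have *: "\<bar>g y - g x\<bar> \<le> c * \<bar>y - x\<bar>" if xy: "x \<in> {u..v}" "y \<in> {u..v}" "x < y" for x y
  proof -
    obtain z where z: "x < z" "z < y" "g y - g x = (y - x) * g' z"
    proof (rule MVT2[OF xy(3), of g g', THEN exE])
      show "(g has_real_derivative g' z) (at z)" if "x \<le> z" "z \<le> y" for z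
        using that xy by (intro assms(3)) auto
    qed auto
    then show ?thesis using assms(4)[of z] xy z
      by (simp add: abs_mult mult.commute[of c] mult_left_mono)
  qed
  show "cmod (complex_of_real (g x) - complex_of_real (g y)) \<le> c * \<bar>x - y\<bar>"
    if "x \<in> {u..v}" "y \<in> {u..v}" for x y
    using *[of x y] *[of y x] that
    by (cases x y rule: linorder_cases) (auto simp: of_real_diff[symmetric] abs_minus_commute simp del: of_real_diff)
qed

lemma holder_on_gbinomial:
  assumes "0 < \<alpha>" "\<alpha> \<le> 1"
  shows "holder_on {u..v} \<alpha> (\<lambda>t. complex_of_real (t gchoose m))"
proof -
  have "holder_on {u..v} \<alpha> (\<lambda>t. complex_of_real (\<Prod>i<n. t - real i))" for n
  proof (induction n)
    case 0
    then show ?case by (simp add: holder_on_const)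
  next
    case (Suc n)
    have "holder_on {u..v} \<alpha> (\<lambda>t. complex_of_real (t - real n))"
      by (rule holder_on_of_real_deriv[of _ 1 _ _ _ "\<lambda>_. 1"])
         (use assms in \<open>auto intro!: derivative_eq_intros\<close>)
    then show ?case using holder_on_mult[OF Suc _ assms(1)] by simp
  qed
  from holder_on_mult[OF holder_on_const[of _ _ "complex_of_real (1 / fact m)"] this[of m] assms(1)]
  show ?thesis by (simp add: gbinomial_prod_rev atLeast0LessThan)
qed

lemma holder_on_powr:
  assumes "0 < b" "\<alpha> \<le> 1"
  shows "holder_on {u..v} \<alpha> (\<lambda>t. complex_of_real (b powr t))"
proof (rule holder_on_of_real_deriv)
  show "((\<lambda>t. b powr t) has_real_derivative b powr x * ln b) (at x)" for x
    using assms by (auto intro!: derivative_eq_intros)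
  show "\<bar>b powr x * ln b\<bar> \<le> max (b powr u) (b powr v) * \<bar>ln b\<bar>" if x: "x \<in> {u..v}" for x
  proof -
    have "b powr x \<le> max (b powr u) (b powr v)"
    proof (cases "b \<ge> 1")
      case True
      then have "b powr x \<le> b powr v" using x by (intro powr_mono) auto
      then show ?thesis by simp
    next
      case False
      then have "b powr x \<le> b powr u" using x assms by (intro powr_mono') auto
      then show ?thesis by simp
    qed
    then show ?thesis by (simp add: abs_mult mult_right_mono)
  qed
  show "0 \<le> max (b powr u) (b powr v) * \<bar>ln b\<bar>" by (simp add: le_max_iff_disj)
qed (use assms in auto)

lemma holder_on_cis:
  assumes "0 < \<alpha>" "\<alpha> \<le> 1"
  shows "holder_on {u..v} \<alpha> (\<lambda>t. cis (w * t))"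
proof -
  have "holder_on {u..v} \<alpha> (\<lambda>t. complex_of_real (cos (w * t)))"
    by (rule holder_on_of_real_deriv[of _ "\<bar>w\<bar>" _ _ _ "\<lambda>t. - (w * sin (w * t))"])
       (use assms in \<open>auto intro!: derivative_eq_intros mult_left_le simp: abs_mult\<close>)
  moreover have "holder_on {u..v} \<alpha> (\<lambda>t. complex_of_real (sin (w * t)))"
    by (rule holder_on_of_real_deriv[of _ "\<bar>w\<bar>" _ _ _ "\<lambda>t. w * cos (w * t)"])
       (use assms in \<open>auto intro!: derivative_eq_intros mult_left_le simp: abs_mult\<close>)
  ultimately have "holder_on {u..v} \<alpha> (\<lambda>t. complex_of_real (cos (w * t)) + \<i> * complex_of_real (sin (w * t)))"
    by (intro holder_on_add holder_on_mult holder_on_const assms)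
  moreover have "complex_of_real (cos x) + \<i> * complex_of_real (sin x) = cis x" for x
    by (simp add: complex_eq_iff)
  ultimately show ?thesis by simp
qed

lemma periodic_of_int:
  fixes \<phi> :: "real \<Rightarrow> complex"
  assumes "\<And>t. \<phi> (t + 1) = \<phi> t"
  shows "\<phi> (t + of_int n) = \<phi> t"
proof (induction n rule: int_induct[where k = 0])
  case (step1 i)
  then show ?case using assms[of "t + of_int i"] by (simp add: add_ac)
next
  case (step2 i)
  then show ?case using assms[of "t + of_int (i - 1)"] by (simp add: add_ac)
qed simp

text \<open>Length 2 allows two points at distance at most 1 to be moved into the interval by the
  same integer, even with an integer between them. More distant points are reduced separately, which
  only shortens their distance.\<close>

lemma holder_on_periodic:
  assumes per: "\<And>t. \<phi> (t + 1) = \<phi> t" and "holder_on {0..2} \<alpha> \<phi>" and \<alpha>: "0 < \<alpha>"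
  shows "holder_continuous \<alpha> \<phi>"
proof -
  obtain c where c: "c \<ge> 0"
    "\<And>x y. x \<in> {0..2} \<Longrightarrow> y \<in> {0..2} \<Longrightarrow> cmod (\<phi> x - \<phi> y) \<le> c * \<bar>x - y\<bar> powr \<alpha>"
    using assms(2) unfolding holder_on_def by blast
  have shift: "\<phi> (x - of_int n) = \<phi> x" for x n
    using periodic_of_int[of \<phi> "x - of_int n" n, OF per] by simp
  have main: "cmod (\<phi> y - \<phi> x) \<le> c * \<bar>y - x\<bar> powr \<alpha>" if "x \<le> y" for x y
  proof (cases "y \<le> x + 1")
    case True
    have "cmod (\<phi> (y - of_int \<lfloor>x\<rfloor>) - \<phi> (x - of_int \<lfloor>x\<rfloor>))
        \<le> c * \<bar>(y - of_int \<lfloor>x\<rfloor>) - (x - of_int \<lfloor>x\<rfloor>)\<bar> powr \<alpha>"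
      using True that by (intro c(2)) (auto; linarith)+
    then show ?thesis unfolding shift by simp
  next
    case False
    have "cmod (\<phi> (y - of_int \<lfloor>y\<rfloor>) - \<phi> (x - of_int \<lfloor>x\<rfloor>))
        \<le> c * \<bar>(y - of_int \<lfloor>y\<rfloor>) - (x - of_int \<lfloor>x\<rfloor>)\<bar> powr \<alpha>"
      by (intro c(2)) (auto; linarith)+
    also have "\<dots> \<le> c * \<bar>y - x\<bar> powr \<alpha>"
      using False \<alpha> c by (intro mult_left_mono powr_mono2) linarith+
    finally show ?thesis unfolding shift .
  qed
  have "cmod (\<phi> y - \<phi> x) \<le> c * \<bar>y - x\<bar> powr \<alpha>" for x y
    using main[of x y] main[of y x] by (cases "x \<le> y") (auto simp: norm_minus_commute abs_minus_commute)
  then show ?thesis unfolding holder_continuous_def by blast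
qed

text \<open>
  Pascal's rule is what makes the top coefficient periodic once the lower ones are.
\<close>

lemma gbinomial_periodic_expansion:
  fixes g :: "nat \<Rightarrow> real \<Rightarrow> complex"
  assumes "\<And>m t. g m (t + 1) = g m t + a * g (Suc m) t"
    and "\<And>m t. m \<ge> p \<Longrightarrow> g m t = 0"
    and "\<And>m. P (g m)"
    and P_diff: "\<And>f h. P f \<Longrightarrow> P h \<Longrightarrow> P (\<lambda>t. f t - h t)"
    and P_mult: "\<And>f m c. P f \<Longrightarrow> P (\<lambda>t. complex_of_real (t gchoose m) * c * f t)"
  shows "\<exists>\<Phi>. (\<forall>m. P (\<Phi> m) \<and> (\<forall>t. \<Phi> m (t + 1) = \<Phi> m t)) \<and>
      (\<forall>t. g 0 t = (\<Sum>m<p. complex_of_real (t gchoose m) * a ^ m * \<Phi> m t))"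
  using assms(1-3)
proof (induction p arbitrary: g)
  case 0
  have "P (\<lambda>t. 0)" using P_mult[OF 0(3)[of 0], of 0 0] by simp
  then show ?case using 0 by (intro exI[of _ "\<lambda>_ _. 0"]) auto
next
  case (Suc p)
  have "\<exists>\<Phi>. (\<forall>m. P (\<Phi> m) \<and> (\<forall>t. \<Phi> m (t + 1) = \<Phi> m t)) \<and>
      (\<forall>t. g (Suc 0) t = (\<Sum>m<p. complex_of_real (t gchoose m) * a ^ m * \<Phi> m t))"
    by (rule Suc.IH[of "\<lambda>m. g (Suc m)"]) (use Suc.prems in auto)
  then obtain \<Psi> where \<Psi>: "\<And>m. P (\<Psi> m)" "\<And>m t. \<Psi> m (t + 1) = \<Psi> m t"
    "\<And>t. g 1 t = (\<Sum>m<p. complex_of_real (t gchoose m) * a ^ m * \<Psi> m t)" by auto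
  \<comment> \<open>The terms of positive index reuse the coefficients of \<open>g 1\<close> with
    the binomial index raised by one; what is left of \<open>g 0\<close> has to be the periodic term
    of index 0.\<close>
  define \<Phi>0 where "\<Phi>0 t = g 0 t - (\<Sum>m<p. complex_of_real (t gchoose Suc m) * a ^ Suc m * \<Psi> m t)" for t
  have "P (\<lambda>t. g 0 t - (\<Sum>m<n. complex_of_real (t gchoose Suc m) * a ^ Suc m * \<Psi> m t))" for n
  proof (induction n)
    case 0
    then show ?case using Suc.prems(3)[of 0] by simp
  next
    case (Suc n)
    show ?case using P_diff[OF Suc P_mult[OF \<Psi>(1)[of n], of "Suc n" "a ^ Suc n"]]
      by (simp add: diff_diff_eq)
  qed
  then have "P \<Phi>0" unfolding \<Phi>0_def .
  moreover have "\<Phi>0 (t + 1) = \<Phi>0 t" for t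
  proof -
    have "(\<Sum>m<p. complex_of_real ((t + 1) gchoose Suc m) * a ^ Suc m * \<Psi> m (t + 1)) =
        (\<Sum>m<p. complex_of_real (t gchoose Suc m) * a ^ Suc m * \<Psi> m t) + a * g 1 t"
      unfolding \<Psi>(2,3) sum_distrib_left sum.distrib[symmetric]
      unfolding gbinomial_Suc_Suc by (intro sum.cong refl) (simp add: algebra_simps)
    then show ?thesis unfolding \<Phi>0_def Suc.prems(1) by simp
  qed
  moreover have "g 0 t = (\<Sum>m<Suc p. complex_of_real (t gchoose m) * a ^ m * case_nat \<Phi>0 \<Psi> m t)" for t
    unfolding sum.lessThan_Suc_shift by (simp add: \<Phi>0_def)
  ultimately show ?case using \<Psi>(1,2)
    by (intro exI[of _ "case_nat \<Phi>0 \<Psi>"]) (auto split: nat.split)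
qed

lemma powr_eq_power_log:
  assumes "(B::real) > 1" "q > 0" "N > 0"
  shows "N powr log B q = q powr log B N"
  using assms by (simp add: powr_def log_def)

text \<open>The assumption \<open>le\<close> keeps the exponents at most 1, as the smooth factors
  require. The extension \<open>f\<close> is fixed before \<open>r\<close>, so one family of
  periodic functions has all the Hoelder exponents at once.\<close>

lemma jordan_chain_expansion:
  assumes B: "B \<ge> 2" and R: "0 \<le> R" "R < cmod l" and chain: "jordan_chain B R l p a"
    and le: "\<And>r. R < r \<Longrightarrow> cmod l \<le> real B * r"
  shows "\<exists>\<Phi>. (\<forall>m t. \<Phi> m (t + 1) = \<Phi> m t) \<and>
      (\<forall>m r. R < r \<longrightarrow> r < cmod l \<longrightarrow> holder_continuous (log (real B) (cmod l / r)) (\<Phi> m)) \<and>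
      (\<forall>N\<ge>1. a 0 N = (\<Sum>m<p. complex_of_real (real N powr log (real B) (cmod l)) *
                       complex_of_real (log (real B) (real N) gchoose m) *
                       exp (\<i> * complex_of_real (Arg l * log (real B) (real N))) *
                       \<Phi> m (log (real B) (real N))))"
proof -
  have l0: "cmod l > 0" "l \<noteq> 0" using R by auto
  have B1: "real B > 1" using B by simp
  obtain f where ext: "chain_extension B R l p a f"
    using chain_extension_exists[OF B R chain] by blast
  have fB: "f m (real B * x) = l * f m x + f (Suc m) x" if "x \<ge> 0" for m x
    using ext that unfolding chain_extension_def by blast
  \<comment> \<open>\<open>E t\<close> is a branch of \<open>l\<close> to the power
    \<open>t\<close>, and \<open>E'\<close> is its reciprocal, written as a product of factors
    already known to be Hoelder.\<close>
  define E where "E t = complex_of_real (cmod l powr t) * cis (Arg l * t)" for t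
  define E' where "E' t = complex_of_real (inverse (cmod l) powr t) * cis (- Arg l * t)" for t
  have EE: "E t * E' t = 1" for t
  proof -
    have "E t * E' t = complex_of_real (cmod l powr t * inverse (cmod l) powr t) * (cis (Arg l * t) * cis (- Arg l * t))"
      unfolding E_def E'_def by simp
    then show ?thesis using l0 by (simp add: cis_mult powr_mult[symmetric])
  qed
  have E'1: "E' (t + 1) * l = E' t" for t
  proof -
    have "l = complex_of_real (cmod l) * cis (Arg l)"
      using rcis_cmod_Arg[of l] unfolding rcis_def by simp
    then have "E' (t + 1) * l = E' (t + 1) * (complex_of_real (cmod l) * cis (Arg l))" by simp
    also have "\<dots> = complex_of_real (inverse (cmod l) powr (t + 1) * cmod l)
        * (cis (- Arg l * (t + 1)) * cis (Arg l))"
      unfolding E'_def by simp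
    also have "\<dots> = E' t"
      unfolding E'_def cis_mult using l0 by (simp add: powr_add algebra_simps)
    finally show ?thesis .
  qed
  \<comment> \<open>Dividing by \<open>l\<^sup>t\<close> turns multiplication by \<open>B\<close> into the shift \<open>t \<mapsto> t + 1\<close>.\<close>
  define g where "g m t = E' t * f m (real B powr t)" for m t
  \<comment> \<open>Quantifying over \<open>r\<close> inside the regularity class lets the periodic
    coefficients be extracted once for all exponents.\<close>
  define X where "X \<phi> \<longleftrightarrow> (\<forall>r. R < r \<longrightarrow> r < cmod l \<longrightarrow> holder_on {0..2} (log (real B) (cmod l / r)) \<phi>)"
    for \<phi>
  have \<alpha>: "0 < log (real B) (cmod l / r)" "log (real B) (cmod l / r) \<le> 1" if "R < r" "r < cmod l" for r
  proof -
    have "r > 0" using that R by simp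
    then have "1 < cmod l / r" "0 < cmod l / r" using that l0(1) by auto
    then show "0 < log (real B) (cmod l / r)" using B1
      by (subst zero_less_log_cancel_iff) auto
    have "cmod l / r \<le> real B" using le[OF that(1)] \<open>r > 0\<close> by (simp add: field_simps)
    then have "log (real B) (cmod l / r) \<le> log (real B) (real B)"
      using B1 l0 \<open>r > 0\<close> by (subst log_le_cancel_iff) auto
    then show "log (real B) (cmod l / r) \<le> 1" using B1 by simp
  qed
  have Xf: "X (\<lambda>t. f m (real B powr t))" for m
    unfolding X_def
  proof (intro allI impI)
    fix r assume r: "R < r" "r < cmod l"
    define \<alpha> where "\<alpha> = log (real B) (cmod l / r)"
    have r0: "r > 0" using r R by simp
    have \<alpha>1: "0 < \<alpha>" "\<alpha> \<le> 1" using \<alpha>[OF r] unfolding \<alpha>_def by auto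
    have Bpow\<alpha>: "real B powr \<alpha> = cmod l / r" unfolding \<alpha>_def using B1 l0 r0 by simp
    obtain c where c: "c \<ge> 0" "\<And>i k x y. \<lbrakk>0 \<le> x; 0 \<le> y; x < real B ^ i; y < real B ^ i;
        \<bar>x - y\<bar> * real B ^ k \<le> 1\<rbrakk> \<Longrightarrow> cmod (f m x - f m y) \<le> c * r ^ (i + k) / cmod l ^ k"
      using chain_extension_dist_le[OF B R(1) chain ext r] by blast
    obtain c1 where c1: "c1 \<ge> 0"
      "\<And>K x. 0 \<le> x \<Longrightarrow> x < real B ^ K \<Longrightarrow> cmod (f m x - a m (nat \<lfloor>x\<rfloor>)) \<le> c1 * r ^ K"
      using ext r unfolding chain_extension_def by blast
    \<comment> \<open>For \<open>t\<close> in [0, 2] the point \<open>B powr t\<close> is at most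
      \<open>B ^ 2\<close>, hence strictly below \<open>B ^ 3\<close>; there \<open>f m\<close> is
      bounded because it is close to finitely many values of \<open>a m\<close>.\<close>
    define M where "M = c1 * r ^ 3 + Max ((\<lambda>n. cmod (a m n)) ` {..<B ^ 3})"
    have M: "cmod (f m x) \<le> M" if "0 \<le> x" "x < real B ^ 3" for x
    proof -
      have "cmod (a m (nat \<lfloor>x\<rfloor>)) \<le> Max ((\<lambda>n. cmod (a m n)) ` {..<B ^ 3})"
        using nat_floor_less_power[OF that] by (intro Max_ge) auto
      moreover have "cmod (f m x) \<le> cmod (f m x - a m (nat \<lfloor>x\<rfloor>)) + cmod (a m (nat \<lfloor>x\<rfloor>))"
        using norm_triangle_ineq[of "f m x - a m (nat \<lfloor>x\<rfloor>)" "a m (nat \<lfloor>x\<rfloor>)"] by simp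
      ultimately show ?thesis using c1(2)[OF that] unfolding M_def by linarith
    qed
    have "cmod (f m 0) \<le> M" by (rule M) (use B1 in auto)
    then have M0: "M \<ge> 0" by (rule order_trans[OF norm_ge_zero])
    \<comment> \<open>The first summand serves distances at most 1, its factor
      \<open>cmod l / r\<close> paying for the rounding of \<open>k\<close> below;
      \<open>2 * M\<close> serves larger distances.\<close>
    define C where "C = c * r ^ 3 * (cmod l / r) + 2 * M"
    have C0: "C \<ge> 0" unfolding C_def using c M0 r0 by simp
    have fC: "cmod (f m x - f m y) \<le> C * \<bar>x - y\<bar> powr \<alpha>"
      if xy: "0 \<le> x" "0 \<le> y" "x < real B ^ 3" "y < real B ^ 3" for x y
    proof -
      define \<delta> where "\<delta> = \<bar>x - y\<bar>"
      consider "\<delta> = 0" | "\<delta> > 1" | "0 < \<delta>" "\<delta> \<le> 1" unfolding \<delta>_def by linarith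
      then show ?thesis
      proof cases
        case 1
        then show ?thesis unfolding \<delta>_def by simp
      next
        case 2
        have "cmod (f m x - f m y) \<le> 2 * M"
          using norm_triangle_ineq4[of "f m x" "f m y"] M[of x] M[of y] xy by linarith
        also have "\<dots> \<le> C" unfolding C_def using c r0 by simp
        also have "\<dots> \<le> C * \<delta> powr \<alpha>"
          using mult_left_mono[OF ge_one_powr_ge_zero[of \<delta> \<alpha>] C0] 2 \<alpha>1 by simp
        finally show ?thesis unfolding \<delta>_def .
      next
        case 3
        \<comment> \<open>The largest \<open>k\<close> with \<open>\<delta> * B ^ k \<le> 1\<close>.
          Since \<open>B powr \<alpha> = cmod l / r\<close>, the decay
          \<open>(r / cmod l) ^ k\<close> is \<open>\<delta> powr \<alpha>\<close> up to one factor
          \<open>cmod l / r\<close>.\<close>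
        define k where "k = nat \<lfloor>- log (real B) \<delta>\<rfloor>"
        have lg: "log (real B) \<delta> \<le> 0" using 3 B1 by simp
        have k: "real k \<le> - log (real B) \<delta>" "- log (real B) \<delta> < real k + 1"
          unfolding k_def using lg by linarith+
        have "real B ^ k = real B powr real k" using B1 by (simp add: powr_realpow)
        also have "\<dots> \<le> real B powr (- log (real B) \<delta>)" using k B1 by (intro powr_mono) auto
        also have "\<dots> = 1 / \<delta>" using B1 3 by (simp add: powr_minus_divide)
        finally have "\<bar>x - y\<bar> * real B ^ k \<le> 1" using 3 unfolding \<delta>_def[symmetric] by (simp add: field_simps)
        then have "cmod (f m x - f m y) \<le> c * r ^ (3 + k) / cmod l ^ k"
          using xy by (intro c(2))
        also have "\<dots> = c * r ^ 3 * (1 / (cmod l / r) ^ k)"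
          using r0 by (simp add: power_add power_divide)
        also have "1 / (cmod l / r) ^ k \<le> (cmod l / r) * \<delta> powr \<alpha>"
        proof -
          have "1 = (real B powr (- log (real B) \<delta>) * \<delta>) powr \<alpha>"
            using B1 3 by (simp add: powr_minus_divide)
          also have "\<dots> = real B powr (- log (real B) \<delta> * \<alpha>) * \<delta> powr \<alpha>"
            using 3 by (simp add: powr_mult powr_powr)
          also have "\<dots> \<le> real B powr ((real k + 1) * \<alpha>) * \<delta> powr \<alpha>"
            using k B1 \<alpha>1 by (intro mult_right_mono powr_mono) auto
          also have "real B powr ((real k + 1) * \<alpha>) = (real B powr \<alpha>) powr (real (Suc k))"
            by (simp add: powr_powr algebra_simps)
          also have "\<dots> = (cmod l / r) ^ Suc k"
            unfolding Bpow\<alpha> using l0 r0 by (subst powr_realpow) auto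
          finally have "1 \<le> (cmod l / r) * \<delta> powr \<alpha> * (cmod l / r) ^ k" by (simp add: mult_ac)
          moreover have "(cmod l / r) ^ k > 0" using l0 r0 by simp
          ultimately show ?thesis by (simp only: pos_divide_le_eq)
        qed
        finally have "cmod (f m x - f m y) \<le> c * r ^ 3 * ((cmod l / r) * \<delta> powr \<alpha>)"
          using c r0 by (simp add: mult_left_mono)
        also have "\<dots> \<le> C * \<delta> powr \<alpha>" unfolding C_def using M0 by (simp add: algebra_simps)
        finally show ?thesis unfolding \<delta>_def .
      qed
    qed
    \<comment> \<open>On [0, 2] the substitution \<open>x = B powr t\<close> is Lipschitz and
      therefore preserves the Hoelder exponent.\<close>
    have "holder_on {0..2} 1 (\<lambda>t. complex_of_real (real B powr t))"
      using B1 by (intro holder_on_powr) auto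
    then obtain D where D: "D \<ge> 0" "\<And>x y. x \<in> {0..2} \<Longrightarrow> y \<in> {0..2} \<Longrightarrow>
        cmod (complex_of_real (real B powr x) - complex_of_real (real B powr y)) \<le> D * \<bar>x - y\<bar> powr 1"
      unfolding holder_on_def by blast
    have "cmod (f m (real B powr x) - f m (real B powr y)) \<le> (C * D powr \<alpha>) * \<bar>x - y\<bar> powr \<alpha>"
      if xy: "x \<in> {0..2}" "y \<in> {0..2}" for x y
    proof -
      have lt: "real B powr z < real B ^ 3" if "z \<in> {0..2}" for z
      proof -
        have "real B powr z < real B powr real 3" using that B1 by (intro powr_less_mono) auto
        also have "\<dots> = real B ^ 3" using B1 by (intro powr_realpow) auto
        finally show ?thesis .
      qed
      have "cmod (f m (real B powr x) - f m (real B powr y)) \<le> C * \<bar>real B powr x - real B powr y\<bar> powr \<alpha>"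
        using lt xy by (intro fC) auto
      also have "\<bar>real B powr x - real B powr y\<bar> \<le> D * \<bar>x - y\<bar>"
        using D(2)[OF xy] by (simp add: of_real_diff[symmetric] del: of_real_diff)
      then have "C * \<bar>real B powr x - real B powr y\<bar> powr \<alpha> \<le> C * (D * \<bar>x - y\<bar>) powr \<alpha>"
        using C0 \<alpha>1 by (intro mult_left_mono powr_mono2) auto
      also have "\<dots> = (C * D powr \<alpha>) * \<bar>x - y\<bar> powr \<alpha>"
        using D(1) by (simp add: powr_mult)
      finally show ?thesis .
    qed
    then show "holder_on {0..2} (log (real B) (cmod l / r)) (\<lambda>t. f m (real B powr t))"
      unfolding holder_on_def \<alpha>_def[symmetric] using C0 by (intro exI[of _ "C * D powr \<alpha>"]) auto
  qed
  have "\<exists>\<Phi>. (\<forall>m. X (\<Phi> m) \<and> (\<forall>t. \<Phi> m (t + 1) = \<Phi> m t)) \<and>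
      (\<forall>t. g 0 t = (\<Sum>m<p. complex_of_real (t gchoose m) * inverse l ^ m * \<Phi> m t))"
  proof (rule gbinomial_periodic_expansion)
    fix m t
    have "real B powr (t + 1) = real B * real B powr t" using B1 by (simp add: powr_add)
    then have "g m (t + 1) = E' (t + 1) * (l * f m (real B powr t) + f (Suc m) (real B powr t))"
      unfolding g_def using fB by simp
    also have "\<dots> = (E' (t + 1) * l) * f m (real B powr t)
        + inverse l * ((E' (t + 1) * l) * f (Suc m) (real B powr t))"
      using l0 by (simp add: field_simps)
    finally show "g m (t + 1) = g m t + inverse l * g (Suc m) t" unfolding E'1 g_def .
  next
    show "g m t = 0" if "m \<ge> p" for m t
      using ext that unfolding chain_extension_def g_def by simp
  next
    show "X (g m)" for m
      unfolding X_def g_def E'_def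
      by (intro allI impI holder_on_mult holder_on_powr holder_on_cis)
         (use Xf[of m] \<alpha> l0 in \<open>auto simp: X_def\<close>)
  next
    show "X (\<lambda>t. f t - h t)" if "X f" "X h" for f h
      using that \<alpha> unfolding X_def by (auto intro!: holder_on_diff)
    show "X (\<lambda>t. complex_of_real (t gchoose m) * c * f t)" if "X f" for f m c
      using that \<alpha> unfolding X_def by (auto intro!: holder_on_mult holder_on_gbinomial holder_on_const)
  qed
  then obtain \<Phi> where \<Phi>: "\<And>m. X (\<Phi> m)" "\<And>m t. \<Phi> m (t + 1) = \<Phi> m t"
    "\<And>t. g 0 t = (\<Sum>m<p. complex_of_real (t gchoose m) * inverse l ^ m * \<Phi> m t)" by blast
  \<comment> \<open>The constants \<open>inverse l ^ m\<close> are absorbed, since the terms to be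
    produced carry no such factor.\<close>
  define \<Psi> where "\<Psi> m t = inverse l ^ m * \<Phi> m t" for m t
  have "holder_continuous (log (real B) (cmod l / r)) (\<Psi> m)" if "R < r" "r < cmod l" for m r
  proof (rule holder_on_periodic)
    show "\<Psi> m (t + 1) = \<Psi> m t" for t unfolding \<Psi>_def \<Phi>(2) ..
    show "holder_on {0..2} (log (real B) (cmod l / r)) (\<Psi> m)"
      using \<Phi>(1)[of m] that \<alpha>[OF that] unfolding \<Psi>_def X_def
      by (auto intro!: holder_on_mult holder_on_const)
  qed (use \<alpha>[OF that] in auto)
  moreover have "a 0 N = (\<Sum>m<p. complex_of_real (real N powr log (real B) (cmod l)) *
                       complex_of_real (log (real B) (real N) gchoose m) *
                       exp (\<i> * complex_of_real (Arg l * log (real B) (real N))) *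
                       \<Psi> m (log (real B) (real N)))" if "N \<ge> 1" for N
  proof -
    define t where "t = log (real B) (real N)"
    have Bt: "real B powr t = real N" unfolding t_def using that B1 by simp
    have pw: "real N powr log (real B) (cmod l) = cmod l powr t"
      unfolding t_def using that B1 l0 by (intro powr_eq_power_log) auto
    have "a 0 N = f 0 (real B powr t)" using ext unfolding Bt chain_extension_def by simp
    also have "\<dots> = (E t * E' t) * f 0 (real B powr t)" unfolding EE by simp
    also have "\<dots> = E t * g 0 t" unfolding g_def by simp
    also have "\<dots> = (\<Sum>m<p. complex_of_real (cmod l powr t) * complex_of_real (t gchoose m) *
        exp (\<i> * complex_of_real (Arg l * t)) * \<Psi> m t)"
      unfolding \<Phi>(3) \<Psi>_def E_def sum_distrib_left
      by (intro sum.cong refl) (simp add: cis_conv_exp mult_ac)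
    finally show ?thesis unfolding t_def[symmetric] pw .
  qed
  moreover have "\<Psi> m (t + 1) = \<Psi> m t" for m t unfolding \<Psi>_def \<Phi>(2) ..
  ultimately show ?thesis by (intro exI[of _ \<Psi>]) auto
qed

section \<open>Joint spectral radius\<close>

text \<open>Fekete's argument in multiplicative form: the limit is the infimum of the roots. Its
  usable consequence is a bound \<open>c * r ^ n\<close> for all \<open>n\<close>, not merely for
  large ones.\<close>

lemma submultiplicative_root_convergent:
  fixes M :: "nat \<Rightarrow> real"
  assumes nonneg: "\<And>n. M n \<ge> 0" and submult: "\<And>m n. M (m + n) \<le> M m * M n"
  shows "convergent (\<lambda>n. root n (M n))" "lim (\<lambda>n. root n (M n)) \<ge> 0"
    "lim (\<lambda>n. root n (M n)) < r \<Longrightarrow> \<exists>c\<ge>0. \<forall>n. M n \<le> c * r ^ n"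
proof -
  define x where "x n = root n (M n)" for n
  \<comment> \<open>Index 0 is left out because \<open>root 0\<close> is constantly 0.\<close>
  define \<rho> where "\<rho> = Inf (x ` {1..})"
  have x0: "x n \<ge> 0" for n unfolding x_def by (rule real_root_ge_zero[OF nonneg])
  have bdd: "bdd_below (x ` {1..})" using x0 by (intro bdd_belowI[of _ 0]) auto
  have \<rho>0: "\<rho> \<ge> 0" unfolding \<rho>_def using x0 by (intro cInf_greatest) auto
  have bound: "\<exists>c>0. \<forall>n. M n \<le> c * q ^ n" if q: "\<rho> < q" for q
  proof -
    have "x ` {1..} \<noteq> {}" by auto
    then obtain T where T: "T \<ge> 1" "x T < q"
      using q cInf_less_iff[OF _ bdd, of q] unfolding \<rho>_def by auto
    have q0: "q > 0" using q \<rho>0 by simp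
    have MT: "M T \<le> q ^ T"
    proof -
      have "M T = x T ^ T" unfolding x_def using T nonneg by simp
      then show ?thesis using T x0[of T] by (simp add: power_mono)
    qed
    \<comment> \<open>Here \<open>n\<close> is cut into blocks of length \<open>T\<close> and a
      remainder \<open>s < T\<close>. The sum dominates every remainder; the added 1 keeps
      \<open>c\<close> positive, so that its \<open>n\<close>-th root tends to 1.\<close>
    define c where "c = 1 + (\<Sum>s<T. M s / q ^ s)"
    have nn: "0 \<le> M s / q ^ s" for s using nonneg q0 by simp
    have c: "c > 0" unfolding c_def using nn by (simp add: add_pos_nonneg sum_nonneg)
    have small: "M s \<le> c * q ^ s" if "s < T" for s
    proof -
      have "M s / q ^ s \<le> (\<Sum>s<T. M s / q ^ s)"
        using that nn by (intro member_le_sum) auto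
      then have "M s / q ^ s \<le> c" unfolding c_def by simp
      then show ?thesis using q0 by (simp add: divide_le_eq)
    qed
    have step: "M (k * T + s) \<le> c * q ^ (k * T + s)" if "s < T" for k s
    proof (induction k)
      case (Suc k)
      have "M (T + (k * T + s)) \<le> M T * M (k * T + s)" by (rule submult)
      also have "\<dots> \<le> q ^ T * (c * q ^ (k * T + s))"
        using MT Suc nonneg q0 by (intro mult_mono) auto
      finally show ?case by (simp add: power_add mult_ac add_ac)
    qed (use small that in simp)
    have "M n \<le> c * q ^ n" for n
      using step[of "n mod T" "n div T"] T by simp
    then show ?thesis using c by blast
  qed
  have tend: "x \<longlonglongrightarrow> \<rho>"
  proof (rule order_tendstoI)
    fix y assume "y < \<rho>"
    have "\<rho> \<le> x n" if "n \<ge> 1" for n unfolding \<rho>_def using that by (intro cInf_lower bdd) auto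
    then show "\<forall>\<^sub>F n in sequentially. y < x n"
      using \<open>y < \<rho>\<close> by (intro eventually_sequentiallyI[of 1]) (use less_le_trans in blast)
  next
    fix y assume "\<rho> < y"
    then obtain q where q: "\<rho> < q" "q < y" using dense by blast
    obtain c where c: "c > 0" "\<And>n. M n \<le> c * q ^ n" using bound[OF q(1)] by blast
    have q0: "q > 0" using q \<rho>0 by simp
    have "(\<lambda>n. root n c * q) \<longlonglongrightarrow> 1 * q"
      by (intro tendsto_mult LIMSEQ_root_const tendsto_const c)
    then have "\<forall>\<^sub>F n in sequentially. root n c * q < y"
      using q by (intro order_tendstoD) auto
    moreover have "\<forall>\<^sub>F n in sequentially. x n \<le> root n c * q"
    proof (rule eventually_sequentiallyI[of 1])
      fix n :: nat assume n: "1 \<le> n"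
      have "x n \<le> root n (c * q ^ n)" unfolding x_def using c n by (intro real_root_le_mono) auto
      also have "\<dots> = root n c * q" using n q0 by (simp add: real_root_mult real_root_power_cancel)
      finally show "x n \<le> root n c * q" .
    qed
    ultimately show "\<forall>\<^sub>F n in sequentially. x n < y"
      by eventually_elim simp
  qed
  have x_eq: "(\<lambda>n. root n (M n)) = x" unfolding x_def ..
  have lim: "lim (\<lambda>n. root n (M n)) = \<rho>" unfolding x_eq using limI[OF tend] .
  show "convergent (\<lambda>n. root n (M n))" unfolding x_eq using tend by (rule convergentI)
  show "lim (\<lambda>n. root n (M n)) \<ge> 0" unfolding lim by (rule \<rho>0)
  show "\<exists>c\<ge>0. \<forall>n. M n \<le> c * r ^ n" if "lim (\<lambda>n. root n (M n)) < r"
    using bound that unfolding lim by (meson less_imp_le)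
qed

section \<open>Equivalence of norms on complex vectors, and subordinate norms\<close>

lemma norm_on_vec_zero: "norm_on_vec d \<nu> \<Longrightarrow> \<nu> (0\<^sub>v d) = 0"
  using zero_carrier_vec[of d] unfolding norm_on_vec_def by blast

lemma norm_on_vec_triangle:
  "norm_on_vec d \<nu> \<Longrightarrow> x \<in> carrier_vec d \<Longrightarrow> y \<in> carrier_vec d \<Longrightarrow> \<nu> (x + y) \<le> \<nu> x + \<nu> y"
  unfolding norm_on_vec_def by blast

lemma norm_on_vec_le_sum:
  assumes \<nu>: "norm_on_vec d \<nu>" and x: "x \<in> carrier_vec d"
  shows "\<nu> x \<le> (\<Sum>i<d. cmod (x $ i) * \<nu> (unit_vec d i))"
proof -
  define y where "y k = vec d (\<lambda>i. if i < k then x $ i else 0)" for k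
  have yc: "y k \<in> carrier_vec d" for k unfolding y_def by simp
  have "\<nu> (y k) \<le> (\<Sum>i<k. cmod (x $ i) * \<nu> (unit_vec d i))" if "k \<le> d" for k
    using that
  proof (induction k)
    case 0
    have "y 0 = 0\<^sub>v d" unfolding y_def by auto
    then show ?case using norm_on_vec_zero[OF \<nu>] by simp
  next
    case (Suc k)
    have "y (Suc k) = y k + x $ k \<cdot>\<^sub>v unit_vec d k"
      using Suc.prems unfolding y_def by (intro eq_vecI) (auto simp: less_Suc_eq)
    then have "\<nu> (y (Suc k)) \<le> \<nu> (y k) + \<nu> (x $ k \<cdot>\<^sub>v unit_vec d k)"
      using norm_on_vec_triangle[OF \<nu> yc, of "x $ k \<cdot>\<^sub>v unit_vec d k" k] by simp
    also have "\<nu> (x $ k \<cdot>\<^sub>v unit_vec d k) = cmod (x $ k) * \<nu> (unit_vec d k)"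
      using \<nu> unfolding norm_on_vec_def by auto
    finally show ?case using Suc by simp
  qed
  moreover have "y d = x" using x unfolding y_def by (intro eq_vecI) auto
  ultimately show ?thesis by (metis order_refl)
qed

text \<open>Bolzano-Weierstrass for \<open>d\<close> complex coordinates, treated as
  \<open>2 * d\<close> real ones so that a single subsequence serves them all.\<close>

lemma bounded_complex_functions_subseq:
  fixes f :: "nat \<Rightarrow> nat \<Rightarrow> complex"
  assumes "\<And>n i. i < d \<Longrightarrow> cmod (f n i) \<le> b"
  obtains l r where "strict_mono r" "\<And>i. i < d \<Longrightarrow> (\<lambda>n. f (r n) i) \<longlonglongrightarrow> l i"
proof -
  define prj :: "(nat \<Rightarrow> complex) \<Rightarrow> nat \<times> bool \<Rightarrow> real"
    where "prj x = (\<lambda>(i, t). if t then Re (x i) else Im (x i))" for x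
  define unprj :: "(nat \<times> bool \<Rightarrow> real) \<Rightarrow> nat \<Rightarrow> complex"
    where "unprj e = (\<lambda>i. Complex (e (i, True)) (e (i, False)))" for e
  have "bounded ((\<lambda>x. prj x k) ` range f)" if "k \<in> {..<d} \<times> UNIV" for k
  proof (rule boundedI)
    fix y assume "y \<in> (\<lambda>x. prj x k) ` range f"
    then obtain n where y: "y = prj (f n) k" by auto
    define i t where "i = fst k" and "t = snd k"
    have k: "k = (i, t)" "i < d"
      using \<open>k \<in> {..<d} \<times> UNIV\<close> unfolding i_def t_def by auto
    have "norm y \<le> cmod (f n i)"
      unfolding y k prj_def using abs_Re_le_cmod abs_Im_le_cmod by simp
    also have "\<dots> \<le> b" by (rule assms) (rule k)
    finally show "norm y \<le> b" .
  qed
  moreover have "unprj (\<lambda>k. prj x k) = x" for x unfolding unprj_def prj_def by simp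
  moreover have "prj (unprj e) k = e k" for e k unfolding unprj_def prj_def by (cases k) auto
  ultimately have "\<forall>\<delta>\<subseteq>{..<d} \<times> (UNIV :: bool set). \<exists>l r. strict_mono r \<and>
      (\<forall>\<epsilon>>0. \<forall>\<^sub>F n in sequentially. \<forall>i\<in>\<delta>. dist (prj (f (r n)) i) (prj l i) < \<epsilon>)"
    by (intro compact_lemma_general[where unproj = unprj]) auto
  then obtain l r where r: "strict_mono r"
    "\<And>\<epsilon>. \<epsilon> > 0 \<Longrightarrow> \<forall>\<^sub>F n in sequentially. \<forall>i\<in>{..<d} \<times> UNIV. dist (prj (f (r n)) i) (prj l i) < \<epsilon>"
    by blast
  have "(\<lambda>n. f (r n) i) \<longlonglongrightarrow> l i" if i: "i < d" for i
  proof -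
    have "(\<lambda>n. prj (f (r n)) (i, t)) \<longlonglongrightarrow> prj l (i, t)" for t
      unfolding tendsto_iff
    proof (intro allI impI)
      fix \<epsilon> :: real assume "\<epsilon> > 0"
      from r(2)[OF this] show "\<forall>\<^sub>F n in sequentially. dist (prj (f (r n)) (i, t)) (prj l (i, t)) < \<epsilon>"
        by eventually_elim (use i in auto)
    qed
    from this[of True] this[of False] show ?thesis
      unfolding prj_def tendsto_complex_iff by simp
  qed
  then show ?thesis using that r(1) by blast
qed

text \<open>By compactness: counterexamples scaled to coordinate sum 1 have a limit along a
  subsequence with the same sum, whereas \<open>norm_on_vec_le_sum\<close>, applied to the
  differences, forces its norm to be 0.\<close>

lemma sum_le_norm_on_vec:
  assumes \<nu>: "norm_on_vec d \<nu>"
  shows "\<exists>c\<ge>0. \<forall>x\<in>carrier_vec d. (\<Sum>i<d. cmod (x $ i)) \<le> c * \<nu> x"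
proof (rule ccontr)
  assume neg: "\<not> ?thesis"
  have "\<exists>y\<in>carrier_vec d. (\<Sum>i<d. cmod (y $ i)) = 1 \<and> \<nu> y < 1 / real (Suc n)" for n
  proof -
    obtain x where x: "x \<in> carrier_vec d" "(\<Sum>i<d. cmod (x $ i)) > real (Suc n) * \<nu> x"
      using neg by (meson not_le of_nat_0_le_iff)
    define s where "s = (\<Sum>i<d. cmod (x $ i))"
    have "\<nu> x \<ge> 0" using \<nu> x unfolding norm_on_vec_def by blast
    then have "real (Suc n) * \<nu> x \<ge> 0" by simp
    then have s: "s > 0" "real (Suc n) * \<nu> x < s" using x(2) unfolding s_def by linarith+
    define y where "y = complex_of_real (1 / s) \<cdot>\<^sub>v x"
    have "y \<in> carrier_vec d" unfolding y_def using x by simp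
    moreover have "(\<Sum>i<d. cmod (y $ i)) = (\<Sum>i<d. cmod (x $ i)) / s"
      unfolding y_def sum_divide_distrib using x s by (intro sum.cong) (auto simp: norm_divide norm_mult)
    moreover have "\<dots> = 1" using s unfolding s_def by simp
    moreover have "\<nu> y = \<nu> x / s"
      using \<nu> x s unfolding norm_on_vec_def y_def by (auto simp: norm_divide)
    moreover have "\<nu> x / s < 1 / real (Suc n)" using s by (simp add: field_simps)
    ultimately show ?thesis by (intro bexI[of _ y]) auto
  qed
  then obtain y where y: "\<And>n. y n \<in> carrier_vec d" "\<And>n. (\<Sum>i<d. cmod (y n $ i)) = 1"
    "\<And>n. \<nu> (y n) < 1 / real (Suc n)" by metis
  have "cmod (y n $ i) \<le> 1" if "i < d" for n i
    unfolding y(2)[of n, symmetric] using that by (intro member_le_sum) auto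
  then obtain l r where r: "strict_mono r" "\<And>i. i < d \<Longrightarrow> (\<lambda>n. y (r n) $ i) \<longlonglongrightarrow> l i"
    by (rule bounded_complex_functions_subseq[of d "\<lambda>n i. y n $ i" 1]) (assumption, rule that)
  define v where "v = vec d l"
  have vc: "v \<in> carrier_vec d" unfolding v_def by simp
  have "(\<lambda>n. \<Sum>i<d. cmod (y (r n) $ i)) \<longlonglongrightarrow> (\<Sum>i<d. cmod (l i))"
    using r(2) by (intro tendsto_sum tendsto_norm) auto
  then have "1 = (\<Sum>i<d. cmod (l i))" unfolding y(2) LIMSEQ_const_iff .
  then have sum1: "(\<Sum>i<d. cmod (v $ i)) = 1" unfolding v_def by simp
  have "\<nu> v \<le> 1 / real (Suc (r n)) + (\<Sum>i<d. cmod (l i - y (r n) $ i) * \<nu> (unit_vec d i))" for n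
  proof -
    have "v = y (r n) + (v - y (r n))" using vc y(1)[of "r n"] by auto
    then have "\<nu> v \<le> \<nu> (y (r n)) + \<nu> (v - y (r n))"
      using \<nu> vc y(1)[of "r n"] unfolding norm_on_vec_def by (metis minus_carrier_vec)
    also have "\<nu> (v - y (r n)) \<le> (\<Sum>i<d. cmod ((v - y (r n)) $ i) * \<nu> (unit_vec d i))"
      using vc y(1)[of "r n"] by (intro norm_on_vec_le_sum[OF \<nu>]) auto
    also have "\<dots> = (\<Sum>i<d. cmod (l i - y (r n) $ i) * \<nu> (unit_vec d i))"
      using y(1)[of "r n"] by (intro sum.cong) (auto simp: v_def)
    finally show ?thesis using y(3)[of "r n"] by simp
  qed
  moreover have "(\<lambda>n. 1 / real (Suc (r n)) + (\<Sum>i<d. cmod (l i - y (r n) $ i) * \<nu> (unit_vec d i)))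
      \<longlonglongrightarrow> 0 + (\<Sum>i<d. cmod (l i - l i) * \<nu> (unit_vec d i))"
    using r(2) LIMSEQ_subseq_LIMSEQ[OF LIMSEQ_Suc[OF lim_1_over_n] r(1)]
    by (intro tendsto_add tendsto_sum tendsto_mult tendsto_norm tendsto_diff tendsto_const)
       (auto simp: comp_def)
  ultimately have "\<nu> v \<le> 0 + (\<Sum>i<d. cmod (l i - l i) * \<nu> (unit_vec d i))"
    by (intro LIMSEQ_le_const) auto
  then have "\<nu> v = 0" using \<nu> vc unfolding norm_on_vec_def by (simp add: order_antisym)
  then have "v = 0\<^sub>v d" using \<nu> vc unfolding norm_on_vec_def by blast
  then show False using sum1 by simp
qed

text \<open>The defining supremum is meaningful only if the values on the unit ball are bounded
  above; the comparison with the coordinate sum supplies this.\<close>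

lemma subordinate_norm_props:
  assumes \<nu>: "norm_on_vec d \<nu>" and M: "M \<in> carrier_mat d d"
  shows norm_mult_vec_le: "x \<in> carrier_vec d \<Longrightarrow> \<nu> (M *\<^sub>v x) \<le> subordinate_norm d \<nu> M * \<nu> x"
    and subordinate_norm_nonneg: "subordinate_norm d \<nu> M \<ge> 0"
proof -
  define S where "S = {x \<in> carrier_vec d. \<nu> x \<le> 1}"
  note \<nu>0 = norm_on_vec_zero[OF \<nu>]
  obtain c where c: "c \<ge> 0" "\<And>x. x \<in> carrier_vec d \<Longrightarrow> (\<Sum>i<d. cmod (x $ i)) \<le> c * \<nu> x"
    using sum_le_norm_on_vec[OF \<nu>] by blast
  have e0: "\<nu> (unit_vec d i) \<ge> 0" for i using \<nu> unfolding norm_on_vec_def by auto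
  define K where "K = (\<Sum>i<d. (\<Sum>j<d. cmod (M $$ (i, j)) * c) * \<nu> (unit_vec d i))"
  have bdd: "bdd_above ((\<lambda>x. \<nu> (M *\<^sub>v x)) ` S)"
  proof (rule bdd_aboveI2)
    fix x assume "x \<in> S"
    then have x: "x \<in> carrier_vec d" "\<nu> x \<le> 1" unfolding S_def by auto
    have xj: "cmod (x $ j) \<le> c" if "j < d" for j
    proof -
      have "cmod (x $ j) \<le> (\<Sum>i<d. cmod (x $ i))" using that by (intro member_le_sum) auto
      also have "\<dots> \<le> c * \<nu> x" using c x by blast
      also have "\<dots> \<le> c" using x c by (simp add: mult_left_le)
      finally show ?thesis .
    qed
    have "\<nu> (M *\<^sub>v x) \<le> (\<Sum>i<d. cmod ((M *\<^sub>v x) $ i) * \<nu> (unit_vec d i))"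
      using M x by (intro norm_on_vec_le_sum[OF \<nu>]) auto
    also have "\<dots> \<le> K" unfolding K_def
    proof (intro sum_mono mult_right_mono e0)
      fix i assume "i \<in> {..<d}"
      then have "(M *\<^sub>v x) $ i = (\<Sum>j<d. M $$ (i, j) * x $ j)"
        using M x by (auto simp: scalar_prod_def row_def atLeast0LessThan intro!: sum.cong)
      also have "cmod \<dots> \<le> (\<Sum>j<d. cmod (M $$ (i, j)) * c)"
        by (intro sum_norm_le) (auto simp: norm_mult xj mult_left_mono)
      finally show "cmod ((M *\<^sub>v x) $ i) \<le> (\<Sum>j<d. cmod (M $$ (i, j)) * c)" .
    qed
    finally show "\<nu> (M *\<^sub>v x) \<le> K" .
  qed
  have up: "\<nu> (M *\<^sub>v x) \<le> subordinate_norm d \<nu> M" if "x \<in> S" for x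
    unfolding subordinate_norm_def S_def[symmetric] using that by (intro cSUP_upper bdd)
  have "0\<^sub>v d \<in> S" unfolding S_def using \<nu>0 by simp
  moreover have M0: "M *\<^sub>v 0\<^sub>v d = 0\<^sub>v d" using M by (intro eq_vecI) auto
  ultimately show "subordinate_norm d \<nu> M \<ge> 0" using up[of "0\<^sub>v d"] \<nu>0 by simp
  show "\<nu> (M *\<^sub>v x) \<le> subordinate_norm d \<nu> M * \<nu> x" if x: "x \<in> carrier_vec d"
  proof (cases "x = 0\<^sub>v d")
    case True
    then show ?thesis using M0 \<nu>0 by simp
  next
    case False
    have hom: "\<nu> (c \<cdot>\<^sub>v y) = cmod c * \<nu> y" if "y \<in> carrier_vec d" for c y
      using \<nu> that unfolding norm_on_vec_def by blast
    have pos: "\<nu> x > 0" using \<nu> x False unfolding norm_on_vec_def by (metis less_eq_real_def)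
    define y where "y = complex_of_real (1 / \<nu> x) \<cdot>\<^sub>v x"
    have "y \<in> S" unfolding S_def y_def using x pos by (simp add: hom norm_divide)
    then have "\<nu> (M *\<^sub>v y) \<le> subordinate_norm d \<nu> M" by (rule up)
    moreover have "M *\<^sub>v y = complex_of_real (1 / \<nu> x) \<cdot>\<^sub>v (M *\<^sub>v x)"
      unfolding y_def using M x by (rule mult_mat_vec)
    moreover have "M *\<^sub>v x \<in> carrier_vec d" using M x by simp
    ultimately have "\<nu> (M *\<^sub>v x) / \<nu> x \<le> subordinate_norm d \<nu> M"
      using pos by (simp add: hom norm_divide)
    then show ?thesis using pos by (simp add: divide_le_eq)
  qed
qed

lemma subordinate_norm_mult_le:
  assumes \<nu>: "norm_on_vec d \<nu>" and M: "M \<in> carrier_mat d d" and N: "N \<in> carrier_mat d d"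
  shows "subordinate_norm d \<nu> (M * N) \<le> subordinate_norm d \<nu> M * subordinate_norm d \<nu> N"
  unfolding subordinate_norm_def[of d \<nu> "M * N"]
proof (rule cSUP_least)
  have "0\<^sub>v d \<in> {x \<in> carrier_vec d. \<nu> x \<le> 1}"
    using norm_on_vec_zero[OF \<nu>] by simp
  then show "{x \<in> carrier_vec d. \<nu> x \<le> 1} \<noteq> {}" by blast
  fix x assume "x \<in> {x \<in> carrier_vec d. \<nu> x \<le> 1}"
  then have x: "x \<in> carrier_vec d" "\<nu> x \<le> 1" by auto
  have "\<nu> (M * N *\<^sub>v x) = \<nu> (M *\<^sub>v (N *\<^sub>v x))" using M N x by (simp add: assoc_mult_mat_vec)
  also have "\<dots> \<le> subordinate_norm d \<nu> M * \<nu> (N *\<^sub>v x)"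
    using N x by (intro norm_mult_vec_le[OF \<nu> M]) auto
  also have "\<dots> \<le> subordinate_norm d \<nu> M * (subordinate_norm d \<nu> N * \<nu> x)"
    by (intro mult_left_mono norm_mult_vec_le[OF \<nu> N] subordinate_norm_nonneg[OF \<nu> M] x)
  also have "\<dots> \<le> subordinate_norm d \<nu> M * subordinate_norm d \<nu> N"
    using x subordinate_norm_nonneg[OF \<nu> M] subordinate_norm_nonneg[OF \<nu> N]
    by (intro mult_left_mono) (auto intro: mult_left_le)
  finally show "\<nu> (M * N *\<^sub>v x) \<le> subordinate_norm d \<nu> M * subordinate_norm d \<nu> N" .
qed

section \<open>Products of matrices along words\<close>

lemma word_prod_carrier:
  assumes "\<And>b. b < B \<Longrightarrow> A b \<in> carrier_mat d d" "set w \<subseteq> {..<B}"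
  shows "word_prod d A w \<in> carrier_mat d d"
  using assms(2)
proof (induction w)
  case (Cons b w)
  then show ?case using assms(1)[of b] unfolding word_prod_def by simp
qed (simp add: word_prod_def)

lemma word_prod_append:
  assumes "\<And>b. b < B \<Longrightarrow> A b \<in> carrier_mat d d" "set v \<subseteq> {..<B}" "set w \<subseteq> {..<B}"
  shows "word_prod d A (v @ w) = word_prod d A v * word_prod d A w"
  using assms(2)
proof (induction v)
  case Nil
  have "word_prod d A w \<in> carrier_mat d d" by (rule word_prod_carrier[OF assms(1,3)])
  then show ?case by (simp add: word_prod_def)
next
  case (Cons b v)
  have "word_prod d A ((b # v) @ w) = A b * word_prod d A (v @ w)" by (simp add: word_prod_def)
  also have "\<dots> = A b * (word_prod d A v * word_prod d A w)" using Cons by simp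
  also have "\<dots> = (A b * word_prod d A v) * word_prod d A w"
    using Cons.prems assms(3)
    by (intro assoc_mult_mat[symmetric, OF assms(1) word_prod_carrier[OF assms(1)]
        word_prod_carrier[OF assms(1)]]) auto
  also have "A b * word_prod d A v = word_prod d A (b # v)" by (simp add: word_prod_def)
  finally show ?case .
qed

text \<open>The monotone function \<open>root T\<close> commutes with the maximum over words, and
  the maximal norms are submultiplicative because a word can be cut in two.\<close>

lemma joint_spectral_radius_bound:
  assumes \<nu>: "norm_on_vec d \<nu>" and A: "\<And>b. b < B \<Longrightarrow> A b \<in> carrier_mat d d" and B: "B > 0"
  shows "joint_spectral_radius d \<nu> B A \<ge> 0"
    and "joint_spectral_radius d \<nu> B A < r \<Longrightarrow>
      \<exists>c\<ge>0. \<forall>w. set w \<subseteq> {..<B} \<longrightarrow> subordinate_norm d \<nu> (word_prod d A w) \<le> c * r ^ length w"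
proof -
  define W where "W T = {w. length w = T \<and> set w \<subseteq> {..<B}}" for T
  define n where "n w = subordinate_norm d \<nu> (word_prod d A w)" for w
  define M where "M T = Max (n ` W T)" for T
  have fin: "finite (W T)" for T
    unfolding W_def using finite_lists_length_eq[of "{..<B}" T] by (simp add: conj_commute)
  have "replicate T 0 \<in> W T" for T unfolding W_def using B by auto
  then have ne: "W T \<noteq> {}" for T by blast
  have le: "n w \<le> M (length w)" if "set w \<subseteq> {..<B}" for w
    unfolding M_def using that by (intro Max_ge finite_imageI fin imageI) (simp add: W_def)
  have n0: "n w \<ge> 0" if "set w \<subseteq> {..<B}" for w
    unfolding n_def by (rule subordinate_norm_nonneg[OF \<nu> word_prod_carrier[OF A that]])
  have M0: "M T \<ge> 0" for T
  proof -
    have "set (replicate T 0) \<subseteq> {..<B}" using B by auto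
    from order_trans[OF n0[OF this] le[OF this]] show ?thesis by simp
  qed
  have Mm: "M (s + t) \<le> M s * M t" for s t
    unfolding M_def[of "s + t"]
  proof (rule Max.boundedI)
    fix y assume "y \<in> n ` W (s + t)"
    then obtain w where w: "y = n w" "length w = s + t" "set w \<subseteq> {..<B}" unfolding W_def by auto
    have s1: "set (take s w) \<subseteq> {..<B}" "set (drop s w) \<subseteq> {..<B}"
      using w(3) set_take_subset set_drop_subset by fastforce+
    have "y = subordinate_norm d \<nu> (word_prod d A (take s w) * word_prod d A (drop s w))"
      using word_prod_append[OF A s1] w(1) unfolding n_def by simp
    also have "\<dots> \<le> n (take s w) * n (drop s w)"
      unfolding n_def
      by (rule subordinate_norm_mult_le[OF \<nu> word_prod_carrier[OF A s1(1)] word_prod_carrier[OF A s1(2)]])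
    also have "\<dots> \<le> M s * M t"
      using le[OF s1(1)] le[OF s1(2)] n0[OF s1(1)] n0[OF s1(2)] M0 w(2) by (intro mult_mono) auto
    finally show "y \<le> M s * M t" .
  qed (use fin ne in auto)
  have "Max ((\<lambda>w. root T (n w)) ` W T) = root T (M T)" for T
  proof -
    have "mono (root T)"
      by (cases "T = 0") (simp add: mono_def, simp add: mono_def)
    then show ?thesis
      unfolding M_def using mono_Max_commute[of "root T" "n ` W T"] fin ne by (simp add: image_image)
  qed
  then have jsr: "joint_spectral_radius d \<nu> B A = lim (\<lambda>T. root T (M T))"
    unfolding joint_spectral_radius_def W_def n_def by simp
  show "joint_spectral_radius d \<nu> B A \<ge> 0"
    unfolding jsr using M0 Mm by (rule submultiplicative_root_convergent(2))
  assume "joint_spectral_radius d \<nu> B A < r"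
  then obtain c where c: "c \<ge> 0" "\<And>T. M T \<le> c * r ^ T"
    using submultiplicative_root_convergent(3)[of M r] M0 Mm unfolding jsr by blast
  then show "\<exists>c\<ge>0. \<forall>w. set w \<subseteq> {..<B} \<longrightarrow> subordinate_norm d \<nu> (word_prod d A w) \<le> c * r ^ length w"
    using le unfolding n_def[symmetric] by (intro exI[of _ c]) (meson order_trans)
qed

section \<open>Generalized eigenvectors\<close>

text \<open>Nonzero off-diagonal entries occur only inside a Jordan block, whose diagonal is
  constant. The entrywise form lets columns be treated one by one without tracking block
  boundaries.\<close>

lemma jordan_matrix_off_diagonal:
  fixes n_as :: "(nat \<times> 'a :: zero_neq_one) list"
  defines "J \<equiv> jordan_matrix n_as" and "n \<equiv> sum_list (map fst n_as)"
  assumes "i < n" "j < n" "i \<noteq> j" "J $$ (i, j) \<noteq> 0"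
  shows "Suc i = j \<and> J $$ (i, j) = 1 \<and> J $$ (i, i) = J $$ (j, j)"
  using assms(3-6) unfolding J_def n_def
proof (induction n_as arbitrary: i j)
  case (Cons na n_as)
  obtain n a where na: "na = (n, a)" by (cases na)
  let ?m = "sum_list (map fst n_as)"
  let ?J = "jordan_matrix ((n, a) # n_as)"
  have idx: "?J $$ (k, l) = (if k < n then if l < n then jordan_block n a $$ (k, l) else 0
      else if l < n then 0 else jordan_matrix n_as $$ (k - n, l - n))"
    if "k < n + ?m" "l < n + ?m" for k l
    unfolding jordan_matrix_Cons using that by (subst index_mat_four_block) auto
  have lt: "i < n + ?m" "j < n + ?m" and nz: "?J $$ (i, j) \<noteq> 0"
    using Cons.prems na by auto
  show ?case
  proof (cases "i < n")
    case True
    then have "j < n" using nz idx[OF lt] by (auto split: if_splits)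
    then show ?thesis
      using True nz Cons.prems(3) unfolding na by (auto simp: idx split: if_splits)
  next
    case False
    then have "\<not> j < n" using nz idx[OF lt] by (auto split: if_splits)
    then have "Suc (i - n) = j - n \<and> jordan_matrix n_as $$ (i - n, j - n) = 1 \<and>
        jordan_matrix n_as $$ (i - n, i - n) = jordan_matrix n_as $$ (j - n, j - n)"
      using False nz idx[OF lt] lt Cons.prems(3) by (intro Cons.IH) auto
    then show ?thesis
      using False \<open>\<not> j < n\<close> lt unfolding na by (auto simp: idx)
  qed
qed simp

text \<open>The action of \<open>Q - l\<close>, taken as a map on vectors so that its powers are
  iterates.\<close>

definition eigen_shift :: "complex mat \<Rightarrow> complex \<Rightarrow> complex vec \<Rightarrow> complex vec" where
  "eigen_shift Q l v = Q *\<^sub>v v - l \<cdot>\<^sub>v v"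

lemma eigen_shift_carrier:
  "Q \<in> carrier_mat d d \<Longrightarrow> v \<in> carrier_vec d \<Longrightarrow> eigen_shift Q l v \<in> carrier_vec d"
  unfolding eigen_shift_def by simp

lemma eigen_shift_pow_carrier:
  "Q \<in> carrier_mat d d \<Longrightarrow> v \<in> carrier_vec d \<Longrightarrow> (eigen_shift Q l ^^ m) v \<in> carrier_vec d"
  by (induction m) (simp_all add: eigen_shift_carrier)

lemma eigen_shift_zero:
  assumes "Q \<in> carrier_mat d d"
  shows "eigen_shift Q l (0\<^sub>v d) = 0\<^sub>v d"
  unfolding eigen_shift_def using assms by (intro eq_vecI) auto

lemma eigen_shift_pow_zero:
  assumes "Q \<in> carrier_mat d d"
  shows "(eigen_shift Q l ^^ m) (0\<^sub>v d) = 0\<^sub>v d"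
  by (induction m) (simp_all add: eigen_shift_zero[OF assms])

lemma eigen_shift_smult:
  assumes "Q \<in> carrier_mat d d" "v \<in> carrier_vec d"
  shows "eigen_shift Q l (c \<cdot>\<^sub>v v) = c \<cdot>\<^sub>v eigen_shift Q l v"
  unfolding eigen_shift_def mult_mat_vec[OF assms]
  using assms by (intro eq_vecI) (auto simp: algebra_simps)

lemma eigen_shift_pow_smult:
  assumes "Q \<in> carrier_mat d d" "v \<in> carrier_vec d"
  shows "(eigen_shift Q l ^^ m) (c \<cdot>\<^sub>v v) = c \<cdot>\<^sub>v (eigen_shift Q l ^^ m) v"
  by (induction m) (simp_all add: eigen_shift_smult[OF assms(1) eigen_shift_pow_carrier[OF assms]])

text \<open>The last nonzero iterate is an eigenvector. This certifies the eigenvalues attached to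
  the expansion terms.\<close>

lemma generalized_eigenvector_imp_eigenvalue:
  assumes Q: "Q \<in> carrier_mat d d" and v: "v \<in> carrier_vec d" "v \<noteq> 0\<^sub>v d"
    and "(eigen_shift Q l ^^ p) v = 0\<^sub>v d"
  shows "eigenvalue Q l"
  using assms(4)
proof (induction p)
  case (Suc p)
  define w where "w = (eigen_shift Q l ^^ p) v"
  show ?case
  proof (cases "w = 0\<^sub>v d")
    case True
    then show ?thesis using Suc.IH unfolding w_def by simp
  next
    case False
    have w: "w \<in> carrier_vec d" unfolding w_def using Q v by (intro eigen_shift_pow_carrier)
    have "Q *\<^sub>v w - l \<cdot>\<^sub>v w = 0\<^sub>v d" using Suc.prems unfolding w_def eigen_shift_def by simp
    then have "(Q *\<^sub>v w - l \<cdot>\<^sub>v w) $ i = 0" if "i < d" for i using that by simp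
    then have "Q *\<^sub>v w = l \<cdot>\<^sub>v w" using Q w by (intro eq_vecI) auto
    then show ?thesis using Q w False unfolding eigenvalue_def eigenvector_def by auto
  qed
qed (use v in simp)

lemma mult_mat_vec_eq_sum_cols:
  fixes P :: "complex mat"
  assumes "P \<in> carrier_mat d n" "c \<in> carrier_vec n" "i < d"
  shows "(P *\<^sub>v c) $ i = (\<Sum>k<n. c $ k * col P k $ i)"
  using assms by (auto simp: scalar_prod_def atLeast0LessThan mult.commute intro!: sum.cong)

text \<open>The columns of the transformation to Jordan form serve; the uniform exponent
  \<open>d\<close> hides the block sizes.\<close>

lemma generalized_eigenvector_basis:
  assumes Q: "Q \<in> carrier_mat d d"
  obtains P P' l where "P \<in> carrier_mat d d" "P' \<in> carrier_mat d d" "P * P' = 1\<^sub>m d"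
    "\<And>i. i < d \<Longrightarrow> (eigen_shift Q (l i) ^^ d) (col P i) = 0\<^sub>v d"
proof -
  obtain as where "char_poly Q = (\<Prod>a\<leftarrow>as. [:- a, 1:])"
    using char_poly_factorized[OF Q] by blast
  then obtain n_as where jnf: "jordan_nf Q n_as" using jordan_nf_exists[OF Q] by blast
  define J where "J = jordan_matrix n_as"
  obtain P P' where wit: "similar_mat_wit Q J P P'"
    using jnf unfolding jordan_nf_def similar_mat_def J_def by blast
  note W = similar_mat_witD2[OF Q wit]
  have dim: "sum_list (map fst n_as) = d" using W(5) unfolding J_def by (metis carrier_matD(1) jordan_matrix_dim(1))
  have Jent: "Suc i = j \<and> J $$ (i, j) = 1 \<and> J $$ (i, i) = J $$ (j, j)"
    if "i < d" "j < d" "i \<noteq> j" "J $$ (i, j) \<noteq> 0" for i j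
    using jordan_matrix_off_diagonal[of i n_as j] that unfolding dim J_def by blast
  have QP: "Q * P = P * J"
  proof -
    have "Q * P = P * J * P' * P" using W(3) by simp
    also have "\<dots> = P * J * (P' * P)" using W by (intro assoc_mult_mat) auto
    also have "\<dots> = P * J" using W by simp
    finally show ?thesis .
  qed
  have step: "(Q *\<^sub>v col P i) $ j = (\<Sum>k<d. J $$ (k, i) * P $$ (j, k))" if "i < d" "j < d" for i j
  proof -
    have "(Q *\<^sub>v col P i) $ j = (Q * P) $$ (j, i)" using that Q W by simp
    also have "\<dots> = (\<Sum>k<d. J $$ (k, i) * P $$ (j, k))"
      unfolding QP using that W
      by (auto simp: scalar_prod_def atLeast0LessThan mult.commute intro!: sum.cong)
    finally show ?thesis .
  qed
  \<comment> \<open>Inside a block the shift sends column \<open>Suc i\<close> to column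
    \<open>i\<close>, and at the start of a block to 0, so column \<open>i\<close> is killed after
    \<open>Suc i\<close> steps.\<close>
  have nil: "(eigen_shift Q (J $$ (i, i)) ^^ Suc i) (col P i) = 0\<^sub>v d" if "i < d" for i
    using that
  proof (induction i)
    case 0
    have z: "J $$ (k, 0) = 0" if "k < d" "k \<noteq> 0" for k using Jent[of k 0] that 0 by auto
    have "(Q *\<^sub>v col P 0) $ j = J $$ (0, 0) * P $$ (j, 0)" if "j < d" for j
    proof -
      have "(\<Sum>k<d. J $$ (k, 0) * P $$ (j, k)) = (\<Sum>k\<in>{0}. J $$ (k, 0) * P $$ (j, k))"
        using z 0 by (intro sum.mono_neutral_right) auto
      then show ?thesis using step[OF 0 that] by simp
    qed
    then show ?case using Q W 0 by (auto simp: eigen_shift_def intro!: eq_vecI)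
  next
    case (Suc i)
    have z: "J $$ (k, Suc i) = 0" if "k < d" "k \<noteq> i" "k \<noteq> Suc i" for k
      using Jent[of k "Suc i"] that Suc.prems by auto
    have "(Q *\<^sub>v col P (Suc i)) $ j = J $$ (i, Suc i) * P $$ (j, i) + J $$ (Suc i, Suc i) * P $$ (j, Suc i)"
      if "j < d" for j
    proof -
      have "(\<Sum>k<d. J $$ (k, Suc i) * P $$ (j, k)) = (\<Sum>k\<in>{i, Suc i}. J $$ (k, Suc i) * P $$ (j, k))"
        using z Suc.prems by (intro sum.mono_neutral_right) auto
      then show ?thesis using step[OF Suc.prems that] by simp
    qed
    then have shift: "eigen_shift Q (J $$ (Suc i, Suc i)) (col P (Suc i)) = J $$ (i, Suc i) \<cdot>\<^sub>v col P i"
      using Q W Suc.prems by (auto simp: eigen_shift_def intro!: eq_vecI)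
    have ci: "col P i \<in> carrier_vec d" using W Suc.prems by auto
    have "J $$ (i, Suc i) \<cdot>\<^sub>v (eigen_shift Q (J $$ (Suc i, Suc i)) ^^ Suc i) (col P i) = 0\<^sub>v d"
    proof (cases "J $$ (i, Suc i) = 0")
      case True
      then show ?thesis using eigen_shift_pow_carrier[OF Q ci, where l = "J $$ (Suc i, Suc i)" and m = "Suc i"]
        by (intro eq_vecI) auto
    next
      case False
      then have "J $$ (i, i) = J $$ (Suc i, Suc i)" using Jent[of i "Suc i"] Suc.prems by auto
      then show ?thesis using Suc by auto
    qed
    moreover have "(eigen_shift Q (J $$ (Suc i, Suc i)) ^^ Suc (Suc i)) (col P (Suc i)) =
        (eigen_shift Q (J $$ (Suc i, Suc i)) ^^ Suc i) (J $$ (i, Suc i) \<cdot>\<^sub>v col P i)"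
      unfolding shift[symmetric] funpow_Suc_right[of "Suc i"] by simp
    ultimately show ?case unfolding eigen_shift_pow_smult[OF Q ci] by simp
  qed
  have "(eigen_shift Q (J $$ (i, i)) ^^ d) (col P i) = 0\<^sub>v d" if "i < d" for i
  proof -
    have "(eigen_shift Q (J $$ (i, i)) ^^ ((d - Suc i) + Suc i)) (col P i) = 0\<^sub>v d"
      unfolding funpow_add comp_def nil[OF that] by (rule eigen_shift_pow_zero[OF Q])
    then show ?thesis using that by simp
  qed
  then show ?thesis using that[of P P' "\<lambda>i. J $$ (i, i)"] W by blast
qed

section \<open>Summatory functions of linear representations\<close>

text \<open>A prescribed length makes appending a last digit a structural recursion; the leading
  zeros are harmless once \<open>L * A 0 = L\<close>.\<close>

primrec fixed_digits :: "nat \<Rightarrow> nat \<Rightarrow> nat \<Rightarrow> nat list" where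
  "fixed_digits B 0 n = []"
| "fixed_digits B (Suc K) n = fixed_digits B K (n div B) @ [n mod B]"

lemma length_fixed_digits [simp]: "length (fixed_digits B K n) = K"
  by (induction K arbitrary: n) auto

lemma set_fixed_digits: "B > 0 \<Longrightarrow> set (fixed_digits B K n) \<subseteq> {..<B}"
  by (induction K arbitrary: n) auto

lemma radix_expansion_exists:
  assumes B: "B \<ge> 2"
  shows "\<exists>K. n < B ^ K \<and> radix_expansion B n (fixed_digits B K n)"
proof (induction n rule: less_induct)
  case (less n)
  show ?case
  proof (cases "n = 0")
    case True
    then show ?thesis by (intro exI[of _ 0]) (simp add: radix_expansion_def)
  next
    case False
    then have "n div B < n" using B by simp
    from less.IH[OF this] obtain K
      where K: "n div B < B ^ K" "radix_expansion B (n div B) (fixed_digits B K (n div B))" by blast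
    define w where "w = fixed_digits B K (n div B)"
    have w: "w \<noteq> [] \<longrightarrow> hd w \<noteq> 0" "n div B = (\<Sum>i<length w. rev w ! i * B ^ i)"
      using K(2) unfolding radix_expansion_def w_def by blast+
    have sw: "set (w @ [n mod B]) \<subseteq> {..<B}" using set_fixed_digits[of B] B unfolding w_def by auto
    have "hd (w @ [n mod B]) \<noteq> 0"
    proof (cases "w = []")
      case True
      then have "n div B = 0" using w(2) by simp
      then show ?thesis using True False by (metis append_Nil div_mult_mod_eq list.sel(1) mult_0 plus_nat.add_0)
    next
      case False
      then show ?thesis using w(1) by simp
    qed
    moreover have "(\<Sum>i<length (w @ [n mod B]). rev (w @ [n mod B]) ! i * B ^ i) = n"
    proof -
      have "(\<Sum>i<length (w @ [n mod B]). rev (w @ [n mod B]) ! i * B ^ i)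
          = n mod B + (\<Sum>i<length w. B * (rev w ! i * B ^ i))"
        unfolding length_append_singleton sum.lessThan_Suc_shift by (simp add: mult_ac)
      also have "\<dots> = n mod B + B * (n div B)" unfolding sum_distrib_left[symmetric] w(2)[symmetric] ..
      finally show ?thesis by simp
    qed
    ultimately have "radix_expansion B n (w @ [n mod B])" using sw unfolding radix_expansion_def by simp
    moreover have "n < B ^ Suc K"
      using K(1) B by (metis div_less_iff_less_mult mult.commute not_numeral_le_zero not_gr_zero power_Suc)
    ultimately show ?thesis by (intro exI[of _ "Suc K"]) (simp add: w_def)
  qed
qed

lemma sum_lessThan_add:
  fixes f :: "nat \<Rightarrow> 'a :: comm_monoid_add"
  shows "(\<Sum>n<M + k. f n) = (\<Sum>n<M. f n) + (\<Sum>b<k. f (M + b))"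
  by (induction k) (simp_all add: add_ac)

lemma row_mat_mult_vec:
  fixes M :: "complex mat"
  assumes "M \<in> carrier_mat 1 d" "v \<in> carrier_vec d"
  shows "(M *\<^sub>v v) $ 0 = (\<Sum>j<d. M $$ (0, j) * v $ j)"
  using assms by (auto simp: scalar_prod_def atLeast0LessThan intro!: sum.cong)

section \<open>Summatory row vector and its dilation equation\<close>

locale insensitive_representation =
  fixes B d :: nat and L :: "complex mat" and A :: "nat \<Rightarrow> complex mat"
  assumes B: "B \<ge> 2"
    and L: "L \<in> carrier_mat 1 d"
    and A: "\<And>b. b < B \<Longrightarrow> A b \<in> carrier_mat d d"
    and LA0: "L * A 0 = L"
begin

abbreviation "A_sum \<equiv> sum_of_mats d B A"

lemma A_sum: "A_sum \<in> carrier_mat d d" unfolding sum_of_mats_def by simp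

definition value_at :: "nat \<Rightarrow> nat \<Rightarrow> complex vec \<Rightarrow> complex" where
  "value_at K n v = ((L * word_prod d A (fixed_digits B K n)) *\<^sub>v v) $ 0"

text \<open>Since \<open>n < B ^ n\<close>, the length \<open>n\<close> always suffices, and any
  sufficient length gives the value at the true expansion of \<open>n\<close>.\<close>

definition row_sum :: "nat \<Rightarrow> complex vec \<Rightarrow> complex" where
  "row_sum N v = (\<Sum>n<N. value_at n n v)"

lemma word_prod_digits: "word_prod d A (fixed_digits B K n) \<in> carrier_mat d d"
  using B by (intro word_prod_carrier[OF A set_fixed_digits]) auto

lemma value_at_0: "value_at 0 n v = (L *\<^sub>v v) $ 0"
  unfolding value_at_def using L by (simp add: word_prod_def)

lemma value_at_Suc:
  assumes v: "v \<in> carrier_vec d"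
  shows "value_at (Suc K) n v = value_at K (n div B) (A (n mod B) *\<^sub>v v)"
proof -
  let ?W = "word_prod d A (fixed_digits B K (n div B))"
  have b: "n mod B < B" using B by simp
  have "word_prod d A (fixed_digits B (Suc K) n) = ?W * word_prod d A [n mod B]"
    unfolding fixed_digits.simps using B b
    by (intro word_prod_append[OF A set_fixed_digits]) auto
  also have "word_prod d A [n mod B] = A (n mod B)" using A[OF b] by (simp add: word_prod_def)
  finally have "L * word_prod d A (fixed_digits B (Suc K) n) = (L * ?W) * A (n mod B)"
    using assoc_mult_mat[OF L word_prod_digits A[OF b]] by simp
  then show ?thesis
    unfolding value_at_def
    using assoc_mult_mat_vec[OF mult_carrier_mat[OF L word_prod_digits] A[OF b] v] by simp
qed

text \<open>Here \<open>L * A 0 = L\<close> enters: peeling digits off the right end leaves the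
  extra zero next to \<open>L\<close>.\<close>

lemma value_at_leading_zero:
  assumes "v \<in> carrier_vec d" "n < B ^ K"
  shows "value_at (Suc K) n v = value_at K n v"
  using assms
proof (induction K arbitrary: n v)
  case 0
  have A0: "A 0 \<in> carrier_mat d d" using A B by simp
  have "L *\<^sub>v (A 0 *\<^sub>v v) = L *\<^sub>v v"
    using assoc_mult_mat_vec[OF L A0 0(1)] LA0 by simp
  then show ?case using 0 B by (simp add: value_at_Suc value_at_0)
next
  case (Suc K)
  have b: "n mod B < B" using B by simp
  have Av: "A (n mod B) *\<^sub>v v \<in> carrier_vec d" using A[OF b] Suc.prems by simp
  have "n div B < B ^ K" using Suc.prems(2) by (simp add: less_mult_imp_div_less mult.commute)
  from Suc.IH[OF Av this] show ?case using Suc.prems(1) by (simp add: value_at_Suc)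
qed

text \<open>Both lengths are compared with their maximum, one leading zero at a time.\<close>

lemma value_at_stable:
  assumes "v \<in> carrier_vec d" "n < B ^ K"
  shows "value_at n n v = value_at K n v"
proof -
  have mono: "value_at K' n v = value_at K n v" if "K \<le> K'" "n < B ^ K" for K K'
    using that(1)
  proof (induction rule: dec_induct)
    case (step m)
    have "B ^ K \<le> B ^ m" using step B by (intro power_increasing) auto
    then show ?case using value_at_leading_zero[OF assms(1), of n m] step that(2) by simp
  qed simp
  have "n < 2 ^ n" by (rule less_exp)
  also have "(2 :: nat) ^ n \<le> B ^ n" using B by (intro power_mono) auto
  finally have "n < B ^ n" .
  then show ?thesis using mono[of n "max n K"] mono[of K "max n K"] assms by simp
qed

lemma value_at_mult_add:
  assumes v: "v \<in> carrier_vec d" and b: "b < B"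
  shows "value_at (B * n + b) (B * n + b) v = value_at n n (A b *\<^sub>v v)"
proof -
  have "n < 2 ^ n" by (rule less_exp)
  also have "(2 :: nat) ^ n \<le> B ^ n" using B by (intro power_mono) auto
  finally have n: "n < B ^ n" .
  have "B * n + b < B * Suc n" using b by simp
  also have "\<dots> \<le> B * B ^ n" using n by (intro mult_left_mono) auto
  finally have "B * n + b < B ^ Suc n" by simp
  then have "value_at (B * n + b) (B * n + b) v = value_at (Suc n) (B * n + b) v"
    by (rule value_at_stable[OF v])
  also have "\<dots> = value_at n n (A b *\<^sub>v v)"
    using b unfolding value_at_Suc[OF v] by simp
  finally show ?thesis .
qed

lemma value_at_eq_sum:
  assumes "v \<in> carrier_vec d"
  shows "value_at K n v = (\<Sum>j<d. (L * word_prod d A (fixed_digits B K n)) $$ (0, j) * v $ j)"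
  unfolding value_at_def by (rule row_mat_mult_vec[OF mult_carrier_mat[OF L word_prod_digits] assms])

text \<open>Coefficients independent of \<open>v\<close> give linearity in \<open>v\<close> in the
  form in which it is used later.\<close>

lemma row_sum_eq_sum:
  obtains T where "\<And>v. v \<in> carrier_vec d \<Longrightarrow> row_sum N v = (\<Sum>j<d. T j * v $ j)"
proof
  fix v :: "complex vec" assume v: "v \<in> carrier_vec d"
  show "row_sum N v = (\<Sum>j<d. (\<Sum>n<N. (L * word_prod d A (fixed_digits B n n)) $$ (0, j)) * v $ j)"
    unfolding row_sum_def value_at_eq_sum[OF v] sum_distrib_right by (rule sum.swap)
qed

lemma row_sum_zero: "row_sum N (0\<^sub>v d) = 0"
  by (rule row_sum_eq_sum[of N]) simp

lemma row_sum_diff_smult: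
  assumes "v \<in> carrier_vec d" "w \<in> carrier_vec d"
  shows "row_sum N (v - l \<cdot>\<^sub>v w) = row_sum N v - l * row_sum N w"
proof -
  obtain T where T: "\<And>v. v \<in> carrier_vec d \<Longrightarrow> row_sum N v = (\<Sum>j<d. T j * v $ j)"
    using row_sum_eq_sum by blast
  show ?thesis using assms
    by (simp add: T sum_distrib_left sum_subtractf[symmetric] algebra_simps)
qed

lemma value_at_Q:
  assumes v: "v \<in> carrier_vec d"
  shows "(\<Sum>b<B. value_at K n (A b *\<^sub>v v)) = value_at K n (A_sum *\<^sub>v v)"
proof -
  let ?R = "\<lambda>j. (L * word_prod d A (fixed_digits B K n)) $$ (0, j)"
  have Av: "A b *\<^sub>v v \<in> carrier_vec d" if "b < B" for b using A[OF that] v by simp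
  have "(A_sum *\<^sub>v v) $ j = (\<Sum>b<B. (A b *\<^sub>v v) $ j)" if j: "j < d" for j
  proof -
    have "(A_sum *\<^sub>v v) $ j = (\<Sum>i<d. \<Sum>b<B. A b $$ (j, i) * v $ i)"
      using v j by (auto simp: sum_of_mats_def scalar_prod_def atLeast0LessThan sum_distrib_right intro!: sum.cong)
    also have "\<dots> = (\<Sum>b<B. \<Sum>i<d. A b $$ (j, i) * v $ i)" by (rule sum.swap)
    also have "\<dots> = (\<Sum>b<B. (A b *\<^sub>v v) $ j)"
    proof (intro sum.cong refl)
      fix b assume "b \<in> {..<B}"
      then have "A b \<in> carrier_mat d d" using A by simp
      then show "(\<Sum>i<d. A b $$ (j, i) * v $ i) = (A b *\<^sub>v v) $ j"
        using v j by (auto simp: scalar_prod_def atLeast0LessThan intro!: sum.cong)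
    qed
    finally show ?thesis .
  qed
  then have "value_at K n (A_sum *\<^sub>v v) = (\<Sum>j<d. \<Sum>b<B. ?R j * (A b *\<^sub>v v) $ j)"
    using A_sum v by (subst value_at_eq_sum) (auto simp: sum_distrib_left intro!: sum.cong)
  also have "\<dots> = (\<Sum>b<B. \<Sum>j<d. ?R j * (A b *\<^sub>v v) $ j)" by (rule sum.swap)
  also have "\<dots> = (\<Sum>b<B. value_at K n (A b *\<^sub>v v))"
    using Av by (intro sum.cong refl value_at_eq_sum[symmetric]) auto
  finally show ?thesis ..
qed

text \<open>Each integer below \<open>B * N\<close> is uniquely \<open>B * n + b\<close>, and
  summing over the last digit \<open>b\<close> produces the matrix \<open>A_sum\<close>.\<close>

lemma row_sum_mult:
  assumes v: "v \<in> carrier_vec d"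
  shows "row_sum (B * N) v = row_sum N (A_sum *\<^sub>v v)"
proof (induction N)
  case (Suc N)
  have "row_sum (B * N + B) v = row_sum (B * N) v + (\<Sum>b<B. value_at (B * N + b) (B * N + b) v)"
    unfolding row_sum_def by (rule sum_lessThan_add)
  also have "(\<Sum>b<B. value_at (B * N + b) (B * N + b) v) = (\<Sum>b<B. value_at N N (A b *\<^sub>v v))"
    by (intro sum.cong refl value_at_mult_add[OF v]) simp
  finally show ?case using Suc by (simp add: row_sum_def value_at_Q[OF v] add_ac)
qed (simp add: row_sum_def)

text \<open>Recomputed with \<open>K\<close> digits instead of \<open>n\<close>, the value involves
  a product of exactly \<open>K\<close> matrices; hence the exponent.\<close>

lemma value_at_bound:
  assumes \<nu>: "norm_on_vec d \<nu>" and r: "joint_spectral_radius d \<nu> B A < r" and v: "v \<in> carrier_vec d"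
  shows "\<exists>c\<ge>0. \<forall>K n. n < B ^ K \<longrightarrow> cmod (value_at n n v) \<le> c * r ^ K"
proof -
  obtain c where c: "c \<ge> 0" "\<And>w. set w \<subseteq> {..<B} \<Longrightarrow> subordinate_norm d \<nu> (word_prod d A w) \<le> c * r ^ length w"
    using joint_spectral_radius_bound(2)[OF \<nu> A _ r] B by auto
  obtain c1 where c1: "c1 \<ge> 0" "\<And>x. x \<in> carrier_vec d \<Longrightarrow> (\<Sum>i<d. cmod (x $ i)) \<le> c1 * \<nu> x"
    using sum_le_norm_on_vec[OF \<nu>] by blast
  define l where "l = (\<Sum>j<d. cmod (L $$ (0, j)))"
  have l0: "l \<ge> 0" unfolding l_def by (intro sum_nonneg) auto
  have \<nu>v: "\<nu> v \<ge> 0" using \<nu> v unfolding norm_on_vec_def by blast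
  have "cmod (value_at n n v) \<le> (l * (c1 * (c * \<nu> v))) * r ^ K" if n: "n < B ^ K" for n K
  proof -
    let ?W = "word_prod d A (fixed_digits B K n)"
    let ?x = "?W *\<^sub>v v"
    have x: "?x \<in> carrier_vec d" by (rule mult_mat_vec_carrier[OF word_prod_digits v])
    have "value_at n n v = (L *\<^sub>v ?x) $ 0"
      unfolding value_at_stable[OF v n] unfolding value_at_def
      using assoc_mult_mat_vec[OF L word_prod_digits v] by simp
    also have "\<dots> = (\<Sum>j<d. L $$ (0, j) * ?x $ j)"
      by (rule row_mat_mult_vec[OF L x])
    also have "cmod \<dots> \<le> (\<Sum>j<d. cmod (L $$ (0, j)) * (\<Sum>i<d. cmod (?x $ i)))"
      by (intro sum_norm_le) (auto simp: norm_mult intro!: mult_left_mono member_le_sum)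
    also have "\<dots> = l * (\<Sum>i<d. cmod (?x $ i))" unfolding l_def sum_distrib_right ..
    also have "\<dots> \<le> l * (c1 * \<nu> ?x)" using c1(2)[OF x] l0 by (rule mult_left_mono)
    also have "\<dots> \<le> l * (c1 * (subordinate_norm d \<nu> ?W * \<nu> v))"
      by (intro mult_left_mono norm_mult_vec_le[OF \<nu> word_prod_digits v] c1 l0)
    also have "\<dots> \<le> l * (c1 * ((c * r ^ K) * \<nu> v))"
      using c(2)[OF set_fixed_digits[of B K n]] B by (intro mult_left_mono mult_right_mono c1 l0 \<nu>v) auto
    finally show ?thesis by (simp add: mult_ac)
  qed
  then show ?thesis using l0 c1 c \<nu>v by (intro exI[of _ "l * (c1 * (c * \<nu> v))"]) auto
qed

lemma row_sum_jordan_chain: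
  assumes \<nu>: "norm_on_vec d \<nu>" and v: "v \<in> carrier_vec d"
    and nil: "(eigen_shift A_sum l ^^ p) v = 0\<^sub>v d"
  shows "jordan_chain B (joint_spectral_radius d \<nu> B A) l p (\<lambda>m N. row_sum N ((eigen_shift A_sum l ^^ m) v))"
  unfolding jordan_chain_def
proof (intro conjI allI impI)
  note car = eigen_shift_pow_carrier[OF A_sum v]
  fix m N
  let ?w = "(eigen_shift A_sum l ^^ m) v"
  have "row_sum N (eigen_shift A_sum l ?w) = row_sum N (A_sum *\<^sub>v ?w) - l * row_sum N ?w"
    unfolding eigen_shift_def[of A_sum l ?w] using A_sum car by (intro row_sum_diff_smult) auto
  then show "row_sum (B * N) ?w = l * row_sum N ?w + row_sum N ((eigen_shift A_sum l ^^ Suc m) v)"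
    using row_sum_mult[OF car] by simp
next
  fix m N assume "p \<le> m"
  then have "(eigen_shift A_sum l ^^ m) v = (eigen_shift A_sum l ^^ (m - p)) ((eigen_shift A_sum l ^^ p) v)"
    by (metis comp_apply funpow_add le_add_diff_inverse2)
  then show "row_sum N ((eigen_shift A_sum l ^^ m) v) = 0"
    unfolding nil eigen_shift_pow_zero[OF A_sum] by (simp add: row_sum_zero)
next
  fix m
  show "slow B (joint_spectral_radius d \<nu> B A) (\<lambda>N. row_sum N ((eigen_shift A_sum l ^^ m) v))"
    unfolding slow_def row_sum_def
    using value_at_bound[OF \<nu> _ eigen_shift_pow_carrier[OF A_sum v]] by simp
qed (simp add: row_sum_def)

lemma row_sum_basis:
  assumes P: "P \<in> carrier_mat d d" and c: "c \<in> carrier_vec d"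
  shows "row_sum N (P *\<^sub>v c) = (\<Sum>k<d. row_sum N (c $ k \<cdot>\<^sub>v col P k))"
proof -
  obtain T where T: "\<And>v. v \<in> carrier_vec d \<Longrightarrow> row_sum N v = (\<Sum>j<d. T j * v $ j)"
    using row_sum_eq_sum by blast
  have "row_sum N (P *\<^sub>v c) = (\<Sum>j<d. T j * (P *\<^sub>v c) $ j)"
    using P c by (intro T) auto
  also have "\<dots> = (\<Sum>j<d. \<Sum>k<d. T j * (c $ k * col P k $ j))"
    using mult_mat_vec_eq_sum_cols[OF P c] by (intro sum.cong refl) (simp add: sum_distrib_left)
  also have "\<dots> = (\<Sum>k<d. \<Sum>j<d. T j * (c $ k * col P k $ j))" by (rule sum.swap)
  also have "\<dots> = (\<Sum>k<d. row_sum N (c $ k \<cdot>\<^sub>v col P k))"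
    using P by (intro sum.cong refl) (auto simp: T)
  finally show ?thesis .
qed

lemma linear_representation_eq_value_at:
  assumes C: "C \<in> carrier_mat d 1"
    and u: "\<And>n w. radix_expansion B n w \<Longrightarrow> u n = (L * word_prod d A w * C) $$ (0, 0)"
  shows "u n = value_at n n (col C 0)"
proof -
  obtain K where K: "n < B ^ K" "radix_expansion B n (fixed_digits B K n)"
    using radix_expansion_exists[OF B] by blast
  have cC: "col C 0 \<in> carrier_vec d" using C by auto
  have "u n = (L * word_prod d A (fixed_digits B K n) * C) $$ (0, 0)" by (rule u[OF K(2)])
  also have "\<dots> = value_at K n (col C 0)"
    unfolding value_at_def
    using carrier_matD[OF mult_carrier_mat[OF L word_prod_digits[of K n]]] C
    by (simp del: index_mult_mat(2,3) assoc_mult_mat_vec)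
  finally show ?thesis using value_at_stable[OF cC K(1)] by simp
qed

end

section \<open>Asymptotic expansion\<close>

definition expansion_term :: "nat \<Rightarrow> real \<times> real \<times> nat \<times> (real \<Rightarrow> complex) \<Rightarrow> nat \<Rightarrow> complex" where
  "expansion_term B = (\<lambda>(\<rho>, \<theta>, m, \<Phi>) N.
     complex_of_real (real N powr log (real B) \<rho>) *
     complex_of_real (log (real B) (real N) gchoose m) *
     exp (\<i> * complex_of_real (\<theta> * log (real B) (real N))) *
     \<Phi> (log (real B) (real N)))"

definition admissible_term ::
  "nat \<Rightarrow> complex mat \<Rightarrow> real \<Rightarrow> real \<times> real \<times> nat \<times> (real \<Rightarrow> complex) \<Rightarrow> bool" where
  "admissible_term B Q R = (\<lambda>(\<rho>, \<theta>, m, \<Phi>).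
     \<rho> \<ge> 0 \<and> eigenvalue Q (complex_of_real \<rho> * exp (\<i> * complex_of_real \<theta>)) \<and> \<rho> > R \<and>
     (\<forall>t. \<Phi> (t + 1) = \<Phi> t) \<and>
     (\<forall>r. R < r \<and> r < \<rho> \<longrightarrow> holder_continuous (log (real B) (\<rho> / r)) \<Phi>))"

text \<open>The list is chosen before \<open>r\<close>, so one family of terms serves all error
  exponents. With lists, adding expansions is concatenation, and repeated eigenvalues are
  allowed.\<close>

definition expandable :: "nat \<Rightarrow> complex mat \<Rightarrow> real \<Rightarrow> (nat \<Rightarrow> complex) \<Rightarrow> bool" where
  "expandable B Q R a \<longleftrightarrow> (\<exists>ts. (\<forall>t\<in>set ts. admissible_term B Q R t) \<and>
     (\<forall>r>R. (\<lambda>N. a N - (\<Sum>t\<leftarrow>ts. expansion_term B t N)) \<in> O(\<lambda>N. complex_of_real (real N powr log (real B) r))))"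

lemma expandable_add:
  assumes "expandable B Q R a" "expandable B Q R b"
  shows "expandable B Q R (\<lambda>N. a N + b N)"
proof -
  obtain ts where ts: "\<forall>t\<in>set ts. admissible_term B Q R t" "\<And>r. r > R \<Longrightarrow>
      (\<lambda>N. a N - (\<Sum>t\<leftarrow>ts. expansion_term B t N)) \<in> O(\<lambda>N. complex_of_real (real N powr log (real B) r))"
    using assms(1) unfolding expandable_def by blast
  obtain us where us: "\<forall>t\<in>set us. admissible_term B Q R t" "\<And>r. r > R \<Longrightarrow>
      (\<lambda>N. b N - (\<Sum>t\<leftarrow>us. expansion_term B t N)) \<in> O(\<lambda>N. complex_of_real (real N powr log (real B) r))"
    using assms(2) unfolding expandable_def by blast
  have "(\<lambda>N. a N + b N - (\<Sum>t\<leftarrow>ts @ us. expansion_term B t N))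
      \<in> O(\<lambda>N. complex_of_real (real N powr log (real B) r))" if "r > R" for r
    using sum_in_bigo(1)[OF ts(2)[OF that] us(2)[OF that]] by (simp add: algebra_simps)
  then show ?thesis unfolding expandable_def using ts(1) us(1) by (intro exI[of _ "ts @ us"]) auto
qed

lemma expandable_negligible:
  assumes "\<And>r. r > R \<Longrightarrow> a \<in> O(\<lambda>N. complex_of_real (real N powr log (real B) r))"
  shows "expandable B Q R a"
  unfolding expandable_def using assms by (intro exI[of _ "[]"]) simp

lemma expandable_sum:
  "(\<And>i. i < (n::nat) \<Longrightarrow> expandable B Q R (a i)) \<Longrightarrow> expandable B Q R (\<lambda>N. \<Sum>i<n. a i N)"
  by (induction n) (auto intro: expandable_add expandable_negligible)

text \<open>Translates digit count into size: \<open>K\<close> is about the logarithm of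
  \<open>N\<close> to base \<open>B\<close>. The factor \<open>max 1 r\<close> pays for the
  rounding, whether the powers of \<open>r\<close> grow or decay.\<close>

lemma power_bound_imp_bigo:
  fixes a :: "nat \<Rightarrow> complex"
  assumes B: "B \<ge> 2" and r: "r > 0" and c: "c \<ge> 0"
    and a: "\<And>K N. N < B ^ K \<Longrightarrow> cmod (a N) \<le> c * r ^ K"
  shows "a \<in> O(\<lambda>N. complex_of_real (real N powr log (real B) r))"
proof (rule bigoI[where c = "c * max 1 r"], rule eventually_sequentiallyI[of 1])
  fix N :: nat assume N: "1 \<le> N"
  have B1: "real B > 1" using B by simp
  define t where "t = log (real B) (real N)"
  have t0: "t \<ge> 0" unfolding t_def using N B1 by simp
  have Bt: "real B powr t = real N" unfolding t_def using N B1 by simp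
  define k where "k = nat \<lfloor>t\<rfloor>"
  have k: "real k \<le> t" "t < real (Suc k)" unfolding k_def using t0 by linarith+
  have "real N < real B powr real (Suc k)" unfolding Bt[symmetric] using k B1 by (intro powr_less_mono) auto
  also have "\<dots> = real (B ^ Suc k)" using B1 by (subst powr_realpow) auto
  finally have "N < B ^ Suc k" by (simp only: of_nat_less_iff)
  then have "cmod (a N) \<le> c * r ^ Suc k" by (rule a)
  also have "r ^ Suc k \<le> max 1 r * r powr t"
  proof (cases "r \<ge> 1")
    case True
    have "r ^ Suc k = r * r powr real k" using r by (simp add: powr_realpow)
    also have "\<dots> \<le> r * r powr t" using True k by (intro mult_left_mono powr_mono) auto
    finally show ?thesis using True by (simp add: max_def)
  next
    case False
    have "r ^ Suc k = r powr real (Suc k)" using r by (intro powr_realpow[symmetric])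
    also have "\<dots> \<le> r powr t" using False k r by (intro powr_mono') auto
    finally show ?thesis using False by (simp add: max_def)
  qed
  also have "r powr t = real N powr log (real B) r"
    unfolding t_def using B1 r N by (intro powr_eq_power_log[symmetric]) auto
  finally have "cmod (a N) \<le> c * (max 1 r * real N powr log (real B) r)"
    using c by (simp add: mult_left_mono)
  then show "norm (a N) \<le> c * max 1 r * norm (complex_of_real (real N powr log (real B) r))"
    by (simp add: mult_ac)
qed

lemma jordan_chain_expandable:
  assumes B: "B \<ge> 2" and R: "0 \<le> R" and chain: "jordan_chain B R l p a" and ev: "eigenvalue Q l"
  shows "expandable B Q R (a 0)"
proof -
  \<comment> \<open>The middle case, in which the exponents would exceed 1, occurs only if the chain vanishes.\<close>
  consider "cmod l \<le> R" | r where "R < r" "real B * r < cmod l"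
    | "R < cmod l" "\<And>r. R < r \<Longrightarrow> cmod l \<le> real B * r"
    by (meson not_le)
  then show ?thesis
  proof cases
    case 1
    show ?thesis
    proof (rule expandable_negligible)
      fix r assume "r > R"
      then show "a 0 \<in> O(\<lambda>N. complex_of_real (real N powr log (real B) r))"
        using jordan_chain_small[OF B R _ _ chain, of r] 1 R power_bound_imp_bigo[OF B, of r _ "a 0"] by auto
    qed
  next
    case 2
    then have "a 0 = (\<lambda>_. 0)" using jordan_chain_large_eq_0[OF B R 2 chain] by blast
    then show ?thesis by (intro expandable_negligible) simp
  next
    case 3
    obtain \<Phi> where \<Phi>: "\<And>m t. \<Phi> m (t + 1) = \<Phi> m t"
      "\<And>m r. R < r \<Longrightarrow> r < cmod l \<Longrightarrow> holder_continuous (log (real B) (cmod l / r)) (\<Phi> m)"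
      "\<And>N. N \<ge> 1 \<Longrightarrow> a 0 N = (\<Sum>m<p. complex_of_real (real N powr log (real B) (cmod l)) *
                       complex_of_real (log (real B) (real N) gchoose m) *
                       exp (\<i> * complex_of_real (Arg l * log (real B) (real N))) *
                       \<Phi> m (log (real B) (real N)))"
      using jordan_chain_expansion[OF B R 3(1) chain 3(2)] by blast
    define ts where "ts = map (\<lambda>m. (cmod l, Arg l, m, \<Phi> m)) [0..<p]"
    have "complex_of_real (cmod l) * exp (\<i> * complex_of_real (Arg l)) = l"
      using rcis_cmod_Arg[of l] by (simp add: rcis_def cis_conv_exp)
    then have "\<forall>t\<in>set ts. admissible_term B Q R t"
      using ev 3(1) \<Phi>(1,2) unfolding ts_def admissible_term_def by auto
    \<comment> \<open>The expansion is exact for \<open>N \<ge> 1\<close>, hence the error constant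
      0.\<close>
    moreover have "(\<lambda>N. a 0 N - (\<Sum>t\<leftarrow>ts. expansion_term B t N))
        \<in> O(\<lambda>N. complex_of_real (real N powr log (real B) r))" for r
    proof (rule bigoI[where c = 0], rule eventually_sequentiallyI[of 1])
      fix N :: nat assume N: "1 \<le> N"
      have "(\<Sum>t\<leftarrow>ts. expansion_term B t N) = a 0 N"
        unfolding \<Phi>(3)[OF N] ts_def expansion_term_def
        by (simp add: comp_def interv_sum_list_conv_sum_set_nat atLeast0LessThan)
      then show "norm (a 0 N - (\<Sum>t\<leftarrow>ts. expansion_term B t N))
          \<le> 0 * norm (complex_of_real (real N powr log (real B) r))" by simp
    qed
    ultimately show ?thesis unfolding expandable_def by blast
  qed
qed

context insensitive_representation
begin

lemma row_sum_expandable: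
  assumes \<nu>: "norm_on_vec d \<nu>" and C: "C \<in> carrier_vec d"
  shows "expandable B A_sum (joint_spectral_radius d \<nu> B A) (\<lambda>N. row_sum N C)"
proof -
  let ?R = "joint_spectral_radius d \<nu> B A"
  obtain P P' l where P: "P \<in> carrier_mat d d" "P' \<in> carrier_mat d d" "P * P' = 1\<^sub>m d"
    and nil: "\<And>i. i < d \<Longrightarrow> (eigen_shift A_sum (l i) ^^ d) (col P i) = 0\<^sub>v d"
    using generalized_eigenvector_basis[OF A_sum] by blast
  define c where "c = P' *\<^sub>v C"
  have c: "c \<in> carrier_vec d" unfolding c_def using P C by simp
  have "C = (P * P') *\<^sub>v C" using P C by simp
  also have "\<dots> = P *\<^sub>v c" unfolding c_def by (rule assoc_mult_mat_vec[OF P(1,2) C])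
  finally have Pc: "C = P *\<^sub>v c" .
  have "expandable B A_sum ?R (\<lambda>N. row_sum N (c $ k \<cdot>\<^sub>v col P k))" if k: "k < d" for k
  proof -
    let ?v = "c $ k \<cdot>\<^sub>v col P k"
    have colP: "col P k \<in> carrier_vec d" using P k by auto
    have v: "?v \<in> carrier_vec d" using colP by simp
    have nil': "(eigen_shift A_sum (l k) ^^ d) ?v = 0\<^sub>v d"
      unfolding eigen_shift_pow_smult[OF A_sum colP] nil[OF k] by (intro eq_vecI) auto
    \<comment> \<open>A zero component is set aside because only a nonzero vector shows that
      \<open>l k\<close> is an eigenvalue.\<close>
    show ?thesis
    proof (cases "?v = 0\<^sub>v d")
      case True
      show ?thesis unfolding True row_sum_zero by (intro expandable_negligible) simp
    next
      case False
      have "jordan_chain B ?R (l k) d (\<lambda>m N. row_sum N ((eigen_shift A_sum (l k) ^^ m) ?v))"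
        by (rule row_sum_jordan_chain[OF \<nu> v nil'])
      from jordan_chain_expandable[OF B _ this generalized_eigenvector_imp_eigenvalue[OF A_sum v False nil']]
      show ?thesis using joint_spectral_radius_bound(1)[OF \<nu> A] B by simp
    qed
  qed
  then show ?thesis
    unfolding Pc row_sum_basis[OF P(1) c] by (rule expandable_sum)
qed

end

theorem theorem1:
  fixes B d :: nat
    and s u :: "nat \<Rightarrow> complex"
    and L C Q :: "complex mat"
    and A :: "nat \<Rightarrow> complex mat"
    and \<nu> :: "complex vec \<Rightarrow> real"
    and \<rho>star :: real
  assumes "B \<ge> 2"
    and "\<And>n. u n = s n - (if n = 0 then 0 else s (n - 1))"
    and "linear_representation B d L A C u"
    and "L * A 0 = L"
    and "Q = sum_of_mats d B A"
    and "norm_on_vec d \<nu>"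
    and "\<rho>star = joint_spectral_radius d \<nu> B A"
  shows "\<exists>(k :: nat) (\<rho> :: nat \<Rightarrow> real) (\<theta> :: nat \<Rightarrow> real) (m :: nat \<Rightarrow> nat)
            (\<Phi> :: nat \<Rightarrow> real \<Rightarrow> complex).
    (\<forall>j<k. \<rho> j \<ge> 0 \<and> eigenvalue Q (complex_of_real (\<rho> j) * exp (\<i> * complex_of_real (\<theta> j))) \<and>
       \<rho> j > \<rho>star \<and>
       (\<forall>t. \<Phi> j (t + 1) = \<Phi> j t) \<and>
       (\<forall>r. \<rho>star < r \<and> r < \<rho> j \<longrightarrow> holder_continuous (log (real B) (\<rho> j / r)) (\<Phi> j))) \<and>
    (\<forall>r>\<rho>star.
       (\<lambda>N. s N - (\<Sum>j<k. complex_of_real (real N powr log (real B) (\<rho> j)) *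
                       complex_of_real (log (real B) (real N) gchoose m j) *
                       exp (\<i> * complex_of_real (\<theta> j * log (real B) (real N))) *
                       \<Phi> j (log (real B) (real N))))
         \<in> O(\<lambda>N. complex_of_real (real N powr log (real B) r)))"
proof -
  interpret insensitive_representation B d L A
    using assms(1,3,4) unfolding linear_representation_def by unfold_locales auto
  have C: "C \<in> carrier_mat d 1" using assms(3) unfolding linear_representation_def by blast
  then have cC: "col C 0 \<in> carrier_vec d" by auto
  have u: "u n = value_at n n (col C 0)" for n
    by (rule linear_representation_eq_value_at[OF C])
       (use assms(3) in \<open>auto simp: linear_representation_def\<close>)
  \<comment> \<open>The sum runs up to \<open>N\<close> inclusive. Splitting off its last term keeps
    the argument \<open>N\<close> instead of \<open>N + 1\<close>; that term is \<open>u N\<close>,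
    which is negligible.\<close>
  have s: "s N = row_sum N (col C 0) + value_at N N (col C 0)" for N
  proof (induction N)
    case 0
    then show ?case using assms(2)[of 0] u[of 0] by (simp add: row_sum_def)
  next
    case (Suc N)
    then show ?case using assms(2)[of "Suc N"] u[of "Suc N"] by (simp add: row_sum_def)
  qed
  have R0: "\<rho>star \<ge> 0"
    unfolding assms(7) using joint_spectral_radius_bound(1)[OF assms(6) A] B by simp
  have "expandable B Q \<rho>star (\<lambda>N. value_at N N (col C 0))"
  proof (rule expandable_negligible)
    fix r assume r: "r > \<rho>star"
    then obtain c where "c \<ge> 0" "\<And>K n. n < B ^ K \<Longrightarrow> cmod (value_at n n (col C 0)) \<le> c * r ^ K"
      using value_at_bound[OF assms(6) _ cC] unfolding assms(7) by blast
    then show "(\<lambda>N. value_at N N (col C 0)) \<in> O(\<lambda>N. complex_of_real (real N powr log (real B) r))"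
      using r R0 by (intro power_bound_imp_bigo[OF B]) auto
  qed
  then have "expandable B Q \<rho>star (\<lambda>N. row_sum N (col C 0) + value_at N N (col C 0))"
    using row_sum_expandable[OF assms(6) cC] unfolding assms(5,7) by (intro expandable_add)
  then have "expandable B Q \<rho>star s" unfolding s[abs_def, symmetric] .
  then obtain ts where ts: "\<And>t. t \<in> set ts \<Longrightarrow> admissible_term B Q \<rho>star t" "\<And>r. r > \<rho>star \<Longrightarrow>
      (\<lambda>N. s N - (\<Sum>t\<leftarrow>ts. expansion_term B t N)) \<in> O(\<lambda>N. complex_of_real (real N powr log (real B) r))"
    unfolding expandable_def by blast
  define \<rho> \<theta> m \<Phi> where "\<rho> j = fst (ts ! j)" and "\<theta> j = fst (snd (ts ! j))"
    and "m j = fst (snd (snd (ts ! j)))" and "\<Phi> j = snd (snd (snd (ts ! j)))" for j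
  have tsj: "ts ! j = (\<rho> j, \<theta> j, m j, \<Phi> j)" for j
    unfolding \<rho>_def \<theta>_def m_def \<Phi>_def by simp
  have "(\<Sum>t\<leftarrow>ts. expansion_term B t N) = (\<Sum>j<length ts. expansion_term B (ts ! j) N)" for N
    by (simp add: sum_list_sum_nth atLeast0LessThan)
  note sum_eq = this[unfolded tsj expansion_term_def prod.case]
  have "admissible_term B Q \<rho>star (\<rho> j, \<theta> j, m j, \<Phi> j)" if "j < length ts" for j
    using ts(1)[OF nth_mem[OF that]] unfolding tsj .
  note adm = this[unfolded admissible_term_def prod.case]
  show ?thesis
    using adm ts(2)[unfolded expansion_term_def sum_eq[unfolded expansion_term_def]]
    by (intro exI[of _ "length ts"] exI[of _ \<rho>] exI[of _ \<theta>] exI[of _ m] exI[of _ \<Phi>]) simp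
qed

end
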